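(* Let $M_3(\mathbb{C})=A\oplus B$ be a direct vector-space sum of two subalgebras with $\dim A=4$ and $\dim B=5$, where $A$ is unital. Then there is a map $\varphi\colon M_3(\mathbb{C})\to M_3(\mathbb{C})$, which is an automorphism or an antiautomorphism of $M_3(\mathbb{C})$, such that $\varphi(B)=M$ and $\varphi(A)=S$, where either $M=\mathrm{Span}\{e_{11},e_{12},e_{13},e_{22},e_{23}\}$ or $M=\mathrm{Span}\{e_{11},e_{12},e_{13},e_{23},e_{33}\}$, and $S$ is one of the following subalgebras (with parameters $m,p\in\mathbb{C}$): (U1) $\mathrm{Span}\{E,e_{21},e_{31},e_{32}\}$; (U2) $\mathrm{Span}\{E,e_{21}+e_{22},e_{31},e_{32}\}$; (U3) $\mathrm{Span}\{E,e_{21},e_{31},e_{32}+e_{22}\}$; (U4) $\mathrm{Span}\{E,\ e_{21}+e_{22},\ e_{31}+e_{13}-e_{23},\ e_{11}+e_{12}+e_{31}+e_{32}\}$; (U5) $\mathrm{Span}\{E,\ e_{21},\ e_{31},\ e_{11}+pe_{22}+(1-p)e_{23}+e_{32}\}$; (U6) $\mathrm{Span}\{E,\ e_{21}-e_{23},\ e_{31}+e_{11}-e_{13}-e_{33},\ e_{11}+e_{12}-e_{13}+pe_{22}+(1-p)e_{23}+e_{32}\}$; (U7) $\mathrm{Span}\{E,\ e_{21}+e_{22},\ e_{31}+m(m+1)(e_{13}-e_{23})-e_{33},\ e_{31}+e_{32}+(m+1)(e_{11}+e_{12})\}$; (U8) $\mathrm{Span}\{E,\ e_{21}+e_{22}-e_{23},\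 (m-p+1)(e_{11}+e_{12}-e_{13})+e_{31}+e_{32}-e_{33},\ e_{11}+e_{31}+(m-1)(m-p+1)e_{13}-m(m-p)e_{23}+(p-1)e_{33}\}$.
   Context: $M_3(\mathbb{C})$ is the algebra of $3\times3$ complex matrices, $e_{ij}$ are the matrix units, $E$ is the identity matrix, and $\mathrm{Span}$ means linear span over $\mathbb{C}$. A subalgebra is a $\mathbb{C}$-linear subspace closed under multiplication; it is called unital if it contains $E$. An automorphism is a $\mathbb{C}$-algebra automorphism of $M_3(\mathbb{C})$; an antiautomorphism is the composition of an automorphism and the transpose map. The phrase "up to transpose and up to action of $\mathrm{Aut}(M_3(\mathbb{C}))$" is expressed in the claim by the existence of $\varphi$. *)

theory Defs
  imports "HOL-Analysis.Analysis"
begin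

type_synonym mat3 = "complex ^ 3 ^ 3"

(* The library's *s on complex^3^3 takes its scalar from complex^3 and *\<^sub>R is real scaling,
   so the complex vector space structure of the matrix algebra is set up here. *)
definition mscale :: "complex \<Rightarrow> mat3 \<Rightarrow> mat3"  (infixr \<open>*\<^sub>C\<close> 75)
  where "c *\<^sub>C X = (\<chi> i j. c * X $ i $ j)"

interpretation mat3: vector_space mscale
  by unfold_locales (simp_all add: mscale_def vec_eq_iff algebra_simps)

(* Indices live in the type 3, whose elements are 1, 2 and 3 (with 3 = 0). *)
definition e :: "3 \<Rightarrow> 3 \<Rightarrow> mat3"
  where "e i j = (\<chi> k l. if k = i \<and> l = j then 1 else 0)"

definition E :: mat3
  where "E = mat 1"

definition subalgebra :: "mat3 set \<Rightarrow> bool"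
  where "subalgebra A \<longleftrightarrow> mat3.subspace A \<and> (\<forall>X\<in>A. \<forall>Y\<in>A. X ** Y \<in> A)"

definition unital :: "mat3 set \<Rightarrow> bool"
  where "unital A \<longleftrightarrow> E \<in> A"

definition direct_decomposition :: "mat3 set \<Rightarrow> mat3 set \<Rightarrow> bool"
  where "direct_decomposition A B \<longleftrightarrow>
    A \<inter> B = {0} \<and> (\<forall>X. \<exists>a\<in>A. \<exists>b\<in>B. X = a + b)"

definition automorphism :: "(mat3 \<Rightarrow> mat3) \<Rightarrow> bool"
  where "automorphism f \<longleftrightarrow>
    Vector_Spaces.linear mscale mscale f \<and> bij f \<and>
    (\<forall>X Y. f (X ** Y) = f X ** f Y) \<and> f E = E"

definition antiautomorphism :: "(mat3 \<Rightarrow> mat3) \<Rightarrow> bool"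
  where "antiautomorphism f \<longleftrightarrow> (\<exists>g. automorphism g \<and> f = g \<circ> transpose)"

end

theory Submission
  imports Defs
begin

text \<open>
  Write \<open>T\<close> for the upper triangular matrices. The proof has two halves, and \<open>T\<close> is what joins them.

  The summand \<open>B\<close>. Since \<open>A\<close> contains \<open>E\<close>, the algebra \<open>B\<close> does not, so by Cayley--Hamilton every
  element of \<open>B\<close> is singular (\<open>nonunital5_singular\<close>). If the second coefficient of the
  characteristic polynomial vanished on all of \<open>B\<close>, then the traceless part of \<open>B\<close>, of dimension at
  least four, would consist of nilpotent matrices that are mutually orthogonal for the trace form;
  pairing its strictly upper triangular elements against the entries below the diagonal
  excludes this (\<open>isotropic_pairing_contradiction\<close>). Hence some element of \<open>B\<close> has a nonzero second
  coefficient, and a polynomial in it is an idempotent of rank two, which can be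
  conjugated to \<open>e 1 1 + e 2 2\<close>. The Peirce decomposition for this idempotent has no
  \<open>(3, 3)\<close> component, and a count of the remaining components shows that, up to an automorphism or
  antiautomorphism, \<open>B\<close> is the set of matrices in \<open>T\<close> whose \<open>(2, 2)\<close> entry, or whose \<open>(3, 3)\<close> entry, is
  zero (\<open>nonunital5_standardisable\<close>).

  The summand \<open>A\<close>. In both cases \<open>T\<close> is the sum of \<open>B\<close> and the scalars. Therefore \<open>A\<close>
  meets \<open>T\<close> exactly in the scalars and together with \<open>T\<close> spans all matrices (\<open>transversal\<close>), a
  condition that is the same for both forms of \<open>B\<close>. Such an \<open>A\<close> has a basis \<open>E, a, b, c\<close> in which
  \<open>a, b, c\<close> have prescribed entries below the diagonal, and an element of \<open>A\<close> is determined by those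
  entries together with one diagonal entry. This makes every product of basis elements computable.
  The square of \<open>a\<close> forces \<open>a\<close> to have rank one (\<open>transversal_rank_one\<close>), so that an upper triangular
  conjugation, which preserves both forms of \<open>B\<close>, turns it into \<open>e 2 1\<close> or \<open>e 2 1 + e 2 2\<close>.
  The other products leave two free parameters in \<open>b\<close> and \<open>c\<close> (\<open>transversal_normal_form\<close>), and
  conjugating by a diagonal matrix brings the algebra into one of the listed forms.
\<close>

section \<open>Entrywise computation and closure properties\<close>

lemma mat3_eq_iff: "X = Y \<longleftrightarrow> (\<forall>i j. X $ i $ j = Y $ i $ j)" for X Y :: mat3
  by (simp add: vec_eq_iff)

lemma mult_component:
  "(X ** Y) $ i $ j = X $ i $ 1 * Y $ 1 $ j + X $ i $ 2 * Y $ 2 $ j + X $ i $ 3 * Y $ 3 $ j"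
  for X Y :: mat3
  by (simp add: matrix_matrix_mult_def sum_3)

lemma mscale_component: "(c *\<^sub>C X) $ i $ j = c * X $ i $ j"
  by (simp add: mscale_def)

lemma e_component: "e k l $ i $ j = (if i = k \<and> j = l then 1 else 0)"
  by (simp add: e_def)

lemma E_component: "E $ i $ j = (if i = j then 1 else 0)"
  by (simp add: E_def mat_def)

lemmas components = mult_component mscale_component e_component E_component

lemma subalgebra_mult: "subalgebra A \<Longrightarrow> X \<in> A \<Longrightarrow> Y \<in> A \<Longrightarrow> X ** Y \<in> A"
  and subalgebra_add: "subalgebra A \<Longrightarrow> X \<in> A \<Longrightarrow> Y \<in> A \<Longrightarrow> X + Y \<in> A"
  and subalgebra_diff: "subalgebra A \<Longrightarrow> X \<in> A \<Longrightarrow> Y \<in> A \<Longrightarrow> X - Y \<in> A"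
  and subalgebra_scale: "subalgebra A \<Longrightarrow> X \<in> A \<Longrightarrow> c *\<^sub>C X \<in> A"
  by (auto simp: subalgebra_def mat3.subspace_add mat3.subspace_diff mat3.subspace_scale)

lemmas subalgebra_closed = subalgebra_mult subalgebra_add subalgebra_diff subalgebra_scale

section \<open>Dimension counts\<close>

lemma span4_iff: "X \<in> mat3.span {a, b, c, d} \<longleftrightarrow>
    (\<exists>p q r s. X = p *\<^sub>C a + q *\<^sub>C b + r *\<^sub>C c + s *\<^sub>C d)"
  unfolding mat3.span_breakdown_eq mat3.span_empty singleton_iff
  by (simp add: algebra_simps)

lemma span5_iff: "X \<in> mat3.span {a, b, c, d, e'} \<longleftrightarrow>
    (\<exists>p q r s t. X = p *\<^sub>C a + q *\<^sub>C b + r *\<^sub>C c + s *\<^sub>C d + t *\<^sub>C e')"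
  unfolding mat3.span_breakdown_eq mat3.span_empty singleton_iff
  by (simp add: algebra_simps)

lemma e_eq_iff: "e i j = e k l \<longleftrightarrow> i = k \<and> j = l"
  by (auto simp: mat3_eq_iff e_component)

interpretation mat3: finite_dimensional_vector_space mscale "(\<lambda>(i, j). e i j) ` UNIV"
proof
  have inj: "inj (\<lambda>(i, j). e i j)" by (auto simp: inj_on_def e_eq_iff)
  have coeff: "(\<Sum>x\<in>(\<lambda>(i, j). e i j) ` UNIV. f x *\<^sub>C x) $ k $ l = f (e k l)" for f k l
  proof -
    have "(\<Sum>x\<in>(\<lambda>(i, j). e i j) ` UNIV. f x *\<^sub>C x) $ k $ l
        = (\<Sum>(i, j)\<in>UNIV. (f (e i j) *\<^sub>C e i j) $ k $ l)"
      using inj by (subst sum.reindex) (auto simp: sum_component case_prod_unfold)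
    also have "\<dots> = (\<Sum>x\<in>UNIV. if x = (k, l) then f (e k l) else 0)"
      by (intro sum.cong) (auto simp: components split: if_splits)
    finally show ?thesis by simp
  qed
  show "finite ((\<lambda>(i, j). e i j) ` UNIV)" by simp
  show "\<not> mat3.dependent ((\<lambda>(i, j). e i j) ` UNIV)"
  proof (rule mat3.independent_if_scalars_zero)
    fix f x
    assume 0: "(\<Sum>x\<in>(\<lambda>(i, j). e i j) ` UNIV. f x *\<^sub>C x) = 0"
      and "x \<in> (\<lambda>(i, j). e i j) ` UNIV"
    then obtain k l where x: "x = e k l" by auto
    show "f x = 0" using coeff[of f k l] 0 x by simp
  qed simp
  show "mat3.span ((\<lambda>(i, j). e i j) ` UNIV) = UNIV"
  proof (rule UNIV_eq_I[symmetric])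
    fix X :: mat3
    define f where "f Y = (\<Sum>k\<in>UNIV. \<Sum>l\<in>UNIV. if Y = e k l then X $ k $ l else 0)" for Y
    have f: "f (e k l) = X $ k $ l" for k l
    proof -
      have "f (e k l) = (\<Sum>i\<in>UNIV. \<Sum>j\<in>UNIV. if k = i \<and> l = j then X $ i $ j else 0)"
        by (simp add: f_def e_eq_iff)
      also have "\<dots> = (\<Sum>i\<in>UNIV. if k = i then X $ i $ l else 0)"
        by (intro sum.cong refl) simp
      finally show ?thesis by simp
    qed
    have "X = (\<Sum>x\<in>(\<lambda>(i, j). e i j) ` UNIV. f x *\<^sub>C x)"
      by (subst mat3_eq_iff) (simp only: coeff f simp_thms)
    also have "\<dots> \<in> mat3.span ((\<lambda>(i, j). e i j) ` UNIV)"
      by (intro mat3.span_sum mat3.span_scale mat3.span_base)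
    finally show "X \<in> mat3.span ((\<lambda>(i, j). e i j) ` UNIV)" .
  qed
qed

interpretation mat3_pair: finite_dimensional_vector_space_pair mscale "(\<lambda>(i, j). e i j) ` UNIV"
    mscale "(\<lambda>(i, j). e i j) ` UNIV"
  by unfold_locales

text \<open>
  A predicate in place of the locale of linear maps, so that coordinates, the trace, and
  members of families of coordinates can be handled by the simplifier.
\<close>
definition functional :: "(mat3 \<Rightarrow> complex) \<Rightarrow> bool"
  where "functional f \<longleftrightarrow> (\<forall>X Y. f (X + Y) = f X + f Y) \<and> (\<forall>c X. f (c *\<^sub>C X) = c * f X)"

text \<open>
  Four functionals cannot separate the points of a five-dimensional space. Nonzero elements of \<open>B\<close>
  with prescribed zeros are obtained in this way. The four values are packed into one matrix so
  that the count of dimensions takes place among matrices only.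
\<close>
lemma common_zero:
  assumes B: "mat3.subspace B" "mat3.dim B = 5"
    and f: "functional f" "functional g" "functional h" "functional k"
  obtains X where "X \<in> B" "X \<noteq> 0" "f X = 0" "g X = 0" "h X = 0" "k X = 0"
proof (rule ccontr)
  assume none: "\<not> thesis"
  note conclude = that
  define F where "F X = f X *\<^sub>C e 1 1 + g X *\<^sub>C e 1 2 + h X *\<^sub>C e 1 3 + k X *\<^sub>C e 2 1" for X
  have F: "Vector_Spaces.linear mscale mscale F"
    using f by unfold_locales
      (auto simp: F_def functional_def mat3_eq_iff components algebra_simps)
  interpret F: Vector_Spaces.linear mscale mscale F by (rule F)
  have "X = 0" if X: "X \<in> B" "F X = 0" for X
  proof -
    have "F X $ i $ j = 0" for i j using X by simp
    from this[of 1 1] this[of 1 2] this[of 1 3] this[of 2 1]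
    have "f X = 0" "g X = 0" "h X = 0" "k X = 0" by (simp_all add: F_def components)
    then show ?thesis using none conclude[of X] X by argo
  qed
  then have "inj_on F B" using B F.inj_on_iff_eq_0 by blast
  then have "inj_on F (mat3.span B)" using B by (metis mat3.span_eq_iff)
  then have "mat3.dim (F ` B) = 5"
    using mat3_pair.dim_image_eq[OF F] B by metis
  moreover have "F X \<in> mat3.span {e 1 1, e 1 2, e 1 3, e 2 1}" for X
    unfolding F_def span4_iff by blast
  then have "mat3.dim (F ` B) \<le> card {e 1 1, e 1 2, e 1 3, e 2 1}"
    by (intro mat3.dim_le_card image_subsetI) simp_all
  moreover have "card {e 1 1, e 1 2, e 1 3, e 2 1} \<le> 4"
    by (simp add: card_insert_if)
  ultimately show False by simp
qed

lemma eq_span_if_subset: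
  assumes "mat3.subspace B" "mat3.dim B = 5" "B \<subseteq> mat3.span S" "finite S" "card S \<le> 5"
  shows "B = mat3.span S"
proof -
  have "mat3.dim (mat3.span S) \<le> card S"
    using assms by (intro mat3.dim_le_card) auto
  then show ?thesis
    using assms by (intro mat3.subspace_dim_equal) auto
qed

lemma functional_component: "functional (\<lambda>X. X $ i $ j)"
  by (simp add: functional_def components)

section \<open>Conjugations, automorphisms and antiautomorphisms\<close>

definition conjugation :: "mat3 \<Rightarrow> mat3 \<Rightarrow> mat3 \<Rightarrow> mat3"
  where "conjugation P Q X = P ** X ** Q"

lemma conjugation_inverse:
  assumes "P ** Q = mat 1"
  shows "conjugation P Q (conjugation Q P X) = X"
proof -
  have "conjugation P Q (conjugation Q P X) = (P ** Q) ** X ** (P ** Q)"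
    by (simp add: conjugation_def matrix_mul_assoc)
  then show ?thesis using assms by simp
qed

lemma conjugation_mult:
  assumes "P ** Q = mat 1"
  shows "conjugation P Q (X ** Y) = conjugation P Q X ** conjugation P Q Y"
proof -
  have "Q ** P = mat 1" using assms matrix_left_right_inverse by blast
  then have "conjugation P Q X ** conjugation P Q Y = P ** X ** mat 1 ** Y ** Q"
    unfolding conjugation_def by (metis matrix_mul_assoc)
  then show ?thesis by (simp add: conjugation_def matrix_mul_assoc)
qed

lemma conjugation_linear: "Vector_Spaces.linear mscale mscale (conjugation P Q)"
  by unfold_locales
    (simp_all add: conjugation_def mat3_eq_iff components algebra_simps)

lemma automorphism_conjugation:
  assumes "P ** Q = mat 1"
  shows "automorphism (conjugation P Q)"
proof -
  have QP: "Q ** P = mat 1" using assms matrix_left_right_inverse by blast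
  have "bij (conjugation P Q)"
    by (rule o_bij[of "conjugation Q P"])
      (auto simp: conjugation_inverse[OF assms] conjugation_inverse[OF QP])
  moreover have "conjugation P Q E = E"
    by (simp add: conjugation_def E_def assms)
  ultimately show ?thesis
    by (simp add: automorphism_def conjugation_mult[OF assms] conjugation_linear)
qed

lemma subalgebra_automorphism_image:
  assumes "automorphism f" "subalgebra A"
  shows "subalgebra (f ` A)"
proof -
  interpret f: Vector_Spaces.linear mscale mscale f
    using assms by (simp add: automorphism_def)
  have "mat3.subspace (f ` A)"
    using assms f.subspace_image by (simp add: subalgebra_def)
  moreover have "f X ** f Y \<in> f ` A" if "X \<in> A" "Y \<in> A" for X Y
    using assms that unfolding automorphism_def subalgebra_def by (metis imageI)
  ultimately show ?thesis
    by (auto simp: subalgebra_def)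
qed

definition symmetry :: "(mat3 \<Rightarrow> mat3) \<Rightarrow> bool"
  where "symmetry f \<longleftrightarrow> automorphism f \<or> antiautomorphism f"

lemma automorphism_comp:
  assumes "automorphism f" "automorphism g"
  shows "automorphism (f \<circ> g)"
proof -
  have "Vector_Spaces.linear mscale mscale (f \<circ> g)"
    using assms unfolding automorphism_def by (metis Vector_Spaces.linear_compose)
  then show ?thesis
    using assms by (simp add: automorphism_def bij_comp)
qed

lemma transpose_linear: "Vector_Spaces.linear mscale mscale transpose"
  by unfold_locales (simp_all add: mat3_eq_iff components transpose_def)

lemma bij_transpose: "bij (transpose :: mat3 \<Rightarrow> mat3)"
  by (rule o_bij[of transpose]) auto

lemma automorphism_transpose_comp:
  assumes g: "automorphism g"
  shows "automorphism (transpose \<circ> g \<circ> transpose)"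
proof -
  have "Vector_Spaces.linear mscale mscale (transpose \<circ> g \<circ> transpose)"
    using g transpose_linear unfolding automorphism_def
    by (metis Vector_Spaces.linear_compose)
  moreover have "bij (transpose \<circ> g \<circ> transpose)"
    using g bij_transpose unfolding automorphism_def by (metis bij_comp)
  ultimately show ?thesis
    using g by (simp add: automorphism_def matrix_transpose_mul E_def transpose_mat)
qed

lemma symmetry_transpose: "symmetry transpose"
proof -
  have "automorphism id"
    by (simp add: automorphism_def mat3.linear_id)
  then show ?thesis unfolding symmetry_def antiautomorphism_def by (metis id_comp)
qed

text \<open>
  Two transposes cancel because transposing before and after an automorphism gives an automorphism
  again; so the automorphisms and antiautomorphisms together are closed under composition.
\<close>
lemma symmetry_comp:
  assumes "symmetry f" "symmetry g"
  shows "symmetry (f \<circ> g)"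
proof -
  obtain f' where f': "automorphism f'" "f = f' \<or> f = f' \<circ> transpose"
    using assms unfolding symmetry_def antiautomorphism_def by blast
  obtain g' where g': "automorphism g'" "g = g' \<or> g = g' \<circ> transpose"
    using assms unfolding symmetry_def antiautomorphism_def by blast
  define g'' where "g'' = transpose \<circ> g' \<circ> transpose"
  have g'': "automorphism g''" unfolding g''_def using g' automorphism_transpose_comp by blast
  have comm: "f' \<circ> transpose \<circ> g' = f' \<circ> g'' \<circ> transpose"
    by (auto simp: g''_def)
  have comm': "f' \<circ> transpose \<circ> (g' \<circ> transpose) = f' \<circ> g''"
    by (auto simp: g''_def)
  have "f \<circ> g \<in> {f' \<circ> g', f' \<circ> g' \<circ> transpose, f' \<circ> g'' \<circ> transpose, f' \<circ> g''}"
    using f'(2) g'(2) comm comm' by (auto simp: comp_assoc)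
  moreover have "symmetry h" "symmetry (h \<circ> transpose)" if "automorphism h" for h
    using that unfolding symmetry_def antiautomorphism_def by metis+
  ultimately show ?thesis
    using automorphism_comp[OF f'(1) g'(1)] automorphism_comp[OF f'(1) g''] by auto
qed

lemma symmetry_linear: "symmetry f \<Longrightarrow> Vector_Spaces.linear mscale mscale f"
  unfolding symmetry_def antiautomorphism_def automorphism_def
  using Vector_Spaces.linear_compose[OF transpose_linear] by auto

lemma symmetry_bij: "symmetry f \<Longrightarrow> bij f"
  unfolding symmetry_def antiautomorphism_def automorphism_def
  using bij_comp[OF bij_transpose] by auto

lemma symmetry_E: "symmetry f \<Longrightarrow> f E = E"
  unfolding symmetry_def antiautomorphism_def automorphism_def
  by (auto simp: E_def transpose_mat)

lemma subalgebra_transpose_image: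
  assumes "subalgebra A"
  shows "subalgebra (transpose ` A)"
proof -
  interpret t: Vector_Spaces.linear mscale mscale transpose by (rule transpose_linear)
  have "mat3.subspace (transpose ` A)"
    using assms t.subspace_image by (simp add: subalgebra_def)
  moreover have "transpose X ** transpose Y \<in> transpose ` A" if "X \<in> A" "Y \<in> A" for X Y
    using assms that unfolding subalgebra_def by (metis imageI matrix_transpose_mul)
  ultimately show ?thesis by (auto simp: subalgebra_def)
qed

lemma subalgebra_symmetry_image: "symmetry f \<Longrightarrow> subalgebra A \<Longrightarrow> subalgebra (f ` A)"
  unfolding symmetry_def antiautomorphism_def
  by (auto simp only: image_comp[symmetric] subalgebra_automorphism_image subalgebra_transpose_image)

lemma direct_decomposition_symmetry_image:
  assumes f: "symmetry f" and AB: "direct_decomposition A B"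
  shows "direct_decomposition (f ` A) (f ` B)"
proof -
  interpret f: Vector_Spaces.linear mscale mscale f using f by (rule symmetry_linear)
  have b: "bij f" using f by (rule symmetry_bij)
  have "f ` A \<inter> f ` B = f ` (A \<inter> B)" using b by (simp add: bij_is_inj image_Int)
  then have "f ` A \<inter> f ` B = {0}" using AB by (simp add: direct_decomposition_def f.zero)
  moreover have "\<exists>a\<in>f ` A. \<exists>b\<in>f ` B. X = a + b" for X
  proof -
    obtain Y where Y: "X = f Y" using b by (metis bij_pointE)
    obtain a b where "a \<in> A" "b \<in> B" "Y = a + b" using AB unfolding direct_decomposition_def by blast
    then show ?thesis using Y f.add by blast
  qed
  ultimately show ?thesis by (simp add: direct_decomposition_def)
qed

lemma dim_symmetry_image:
  assumes "symmetry f"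
  shows "mat3.dim (f ` B) = mat3.dim B"
proof (rule mat3_pair.dim_image_eq)
  show "Vector_Spaces.linear mscale mscale f" using assms by (rule symmetry_linear)
  show "inj_on f (mat3.span B)"
    using symmetry_bij[OF assms] by (meson bij_is_inj inj_on_subset top_greatest)
qed

lemma symmetry_conjugation: "P ** Q = mat 1 \<Longrightarrow> symmetry (conjugation P Q)"
  by (simp add: symmetry_def automorphism_conjugation)

section \<open>Upper triangular conjugations and the two standard subalgebras\<close>

definition upper :: "mat3 \<Rightarrow> bool"
  where "upper X \<longleftrightarrow> X $ 2 $ 1 = 0 \<and> X $ 3 $ 1 = 0 \<and> X $ 3 $ 2 = 0"

lemma upper_mult: "upper X \<Longrightarrow> upper Y \<Longrightarrow> upper (X ** Y)"
  by (simp add: upper_def components)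

lemma upper_conjugation: "upper P \<Longrightarrow> upper Q \<Longrightarrow> upper X \<Longrightarrow> upper (conjugation P Q X)"
  by (simp add: conjugation_def upper_mult)

text \<open>
  Both factors are required to be upper triangular, which spares an argument that inverses of upper
  triangular matrices are upper triangular.
\<close>
definition upper_conjugation_map :: "(mat3 \<Rightarrow> mat3) \<Rightarrow> bool"
  where "upper_conjugation_map f \<longleftrightarrow>
    (\<exists>P Q. upper P \<and> upper Q \<and> P ** Q = mat 1 \<and> f = conjugation P Q)"

lemma upper_conjugation_map_symmetry: "upper_conjugation_map f \<Longrightarrow> symmetry f"
  by (auto simp: upper_conjugation_map_def symmetry_conjugation)

definition upper_vanishing :: "3 \<Rightarrow> mat3 set"
  where "upper_vanishing k = {X. upper X \<and> X $ k $ k = 0}"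

lemma upper_vanishing_3_eq_span:
  "upper_vanishing 3 = mat3.span {e 1 1, e 1 2, e 1 3, e 2 2, e 2 3}"
proof -
  have "X = (X $ 1 $ 1) *\<^sub>C e 1 1 + (X $ 1 $ 2) *\<^sub>C e 1 2 + (X $ 1 $ 3) *\<^sub>C e 1 3
      + (X $ 2 $ 2) *\<^sub>C e 2 2 + (X $ 2 $ 3) *\<^sub>C e 2 3" if "X \<in> upper_vanishing 3" for X
    using that by (simp add: upper_vanishing_def upper_def mat3_eq_iff forall_3 components)
  then show ?thesis
    unfolding set_eq_iff span5_iff
    by (intro allI iffI, blast) (auto simp: upper_vanishing_def upper_def components)
qed

lemma upper_vanishing_2_eq_span:
  "upper_vanishing 2 = mat3.span {e 1 1, e 1 2, e 1 3, e 2 3, e 3 3}"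
proof -
  have "X = (X $ 1 $ 1) *\<^sub>C e 1 1 + (X $ 1 $ 2) *\<^sub>C e 1 2 + (X $ 1 $ 3) *\<^sub>C e 1 3
      + (X $ 2 $ 3) *\<^sub>C e 2 3 + (X $ 3 $ 3) *\<^sub>C e 3 3" if "X \<in> upper_vanishing 2" for X
    using that by (simp add: upper_vanishing_def upper_def mat3_eq_iff forall_3 components)
  then show ?thesis
    unfolding set_eq_iff span5_iff
    by (intro allI iffI, blast) (auto simp: upper_vanishing_def upper_def components)
qed

text \<open>
  Diagonal entries of upper triangular matrices multiply. Hence the second half of the proof may
  conjugate \<open>A\<close> by upper triangular matrices without disturbing the normal form of \<open>B\<close>.
\<close>
lemma upper_conjugation_map_upper_vanishing:
  assumes "upper_conjugation_map f"
  shows "f ` upper_vanishing k = upper_vanishing k"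
proof -
  obtain P Q where u: "upper P" "upper Q" and PQ: "P ** Q = mat 1" and f: "f = conjugation P Q"
    using assms unfolding upper_conjugation_map_def by blast
  have diag: "(X ** Y) $ k $ k = X $ k $ k * Y $ k $ k" if "upper X" "upper Y" for X Y
    using that exhaust_3[of k] by (auto simp: upper_def components)
  have sub: "conjugation R S X \<in> upper_vanishing k"
    if "upper R" "upper S" "X \<in> upper_vanishing k" for R S X
    using that diag[of R X] diag[of "R ** X" S] upper_mult
    by (simp add: upper_vanishing_def conjugation_def)
  have "X = f (conjugation Q P X)" for X using conjugation_inverse[OF PQ] by (simp add: f)
  then show ?thesis using sub u unfolding f by blast
qed

section \<open>Five-dimensional subalgebras containing a fixed idempotent of rank two\<close>

definition nonunital5 :: "mat3 set \<Rightarrow> bool"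
  where "nonunital5 B \<longleftrightarrow> subalgebra B \<and> mat3.dim B = 5 \<and> E \<notin> B"

definition standardisable :: "mat3 set \<Rightarrow> bool"
  where "standardisable B \<longleftrightarrow> (\<exists>f. symmetry f \<and>
    (f ` B = upper_vanishing 2 \<or> f ` B = upper_vanishing 3))"

lemma standardisable_symmetry_image:
  assumes "symmetry f" "standardisable (f ` B)"
  shows "standardisable B"
  using assms symmetry_comp unfolding standardisable_def image_comp by blast

lemma nonunital5_symmetry_image:
  assumes f: "symmetry f" and B: "nonunital5 B"
  shows "nonunital5 (f ` B)"
proof -
  have "E \<notin> f ` B"
    using B symmetry_E[OF f] symmetry_bij[OF f] unfolding nonunital5_def
    by (metis bij_is_inj image_iff injD)
  then show ?thesis
    using B subalgebra_symmetry_image[OF f] dim_symmetry_image[OF f]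
    by (simp add: nonunital5_def)
qed

lemma standardisable_if_subset:
  assumes B: "nonunital5 B" and k: "B \<subseteq> upper_vanishing 2 \<or> B \<subseteq> upper_vanishing 3"
  shows "standardisable B"
proof -
  have sub: "mat3.subspace B" "mat3.dim B = 5" using B by (simp_all add: nonunital5_def subalgebra_def)
  have "symmetry id"
    using symmetry_comp[OF symmetry_transpose symmetry_transpose] by (simp add: comp_def id_def)
  moreover have "B = upper_vanishing 2" if "B \<subseteq> upper_vanishing 2"
    using that unfolding upper_vanishing_2_eq_span
    by (rule eq_span_if_subset[OF sub]) (simp_all add: card_insert_if)
  moreover have "B = upper_vanishing 3" if "B \<subseteq> upper_vanishing 3"
    using that unfolding upper_vanishing_3_eq_span
    by (rule eq_span_if_subset[OF sub]) (simp_all add: card_insert_if)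
  ultimately show ?thesis using k unfolding standardisable_def by (intro exI[of _ id]) auto
qed

lemma standardisable_if_conjugate:
  assumes "nonunital5 B" "P ** Q = mat 1"
    and "nonunital5 (conjugation P Q ` B) \<Longrightarrow> standardisable (conjugation P Q ` B)"
  shows "standardisable B"
  using assms symmetry_conjugation nonunital5_symmetry_image standardisable_symmetry_image by metis

context
  fixes B :: "mat3 set"
  assumes B: "nonunital5 B" and g: "e 1 1 + e 2 2 \<in> B"
begin

lemma B_closed: "X \<in> B \<Longrightarrow> Y \<in> B \<Longrightarrow> X ** Y \<in> B" "X \<in> B \<Longrightarrow> Y \<in> B \<Longrightarrow> X + Y \<in> B"
  "X \<in> B \<Longrightarrow> Y \<in> B \<Longrightarrow> X - Y \<in> B" "X \<in> B \<Longrightarrow> c *\<^sub>C X \<in> B"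
  using B by (simp_all add: nonunital5_def subalgebra_closed)

lemma mem_if_scaled_mem: "c *\<^sub>C X \<in> B \<Longrightarrow> c \<noteq> 0 \<Longrightarrow> X \<in> B"
proof -
  assume c: "c *\<^sub>C X \<in> B" "c \<noteq> 0"
  have "(1 / c) *\<^sub>C (c *\<^sub>C X) \<in> B" using c(1) by (rule B_closed)
  then show ?thesis using c(2) by simp
qed

text \<open>
  Otherwise \<open>e 3 3\<close>, and with it the identity matrix, would lie in \<open>B\<close>.
\<close>
lemma corner_zero: assumes X: "X \<in> B" shows "X $ 3 $ 3 = 0"
proof (rule ccontr)
  assume nz: "X $ 3 $ 3 \<noteq> 0"
  let ?g = "e 1 1 + e 2 2"
  have "X - ?g ** X - X ** ?g + ?g ** X ** ?g \<in> B"
    using X g by (simp add: B_closed)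
  moreover have "X - ?g ** X - X ** ?g + ?g ** X ** ?g = (X $ 3 $ 3) *\<^sub>C e 3 3"
    by (simp add: mat3_eq_iff forall_3 components)
  ultimately have "e 3 3 \<in> B" using nz mem_if_scaled_mem by simp
  then have "?g + e 3 3 \<in> B" using g by (simp add: B_closed)
  moreover have "?g + e 3 3 = E" by (simp add: mat3_eq_iff forall_3 components)
  ultimately show False using B by (simp add: nonunital5_def)
qed

lemma column_part: assumes X: "X \<in> B" shows "(X $ 1 $ 3) *\<^sub>C e 1 3 + (X $ 2 $ 3) *\<^sub>C e 2 3 \<in> B"
proof -
  let ?g = "e 1 1 + e 2 2"
  have "?g ** X - ?g ** X ** ?g \<in> B" using X g by (simp add: B_closed)
  moreover have "?g ** X - ?g ** X ** ?g = (X $ 1 $ 3) *\<^sub>C e 1 3 + (X $ 2 $ 3) *\<^sub>C e 2 3"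
    by (simp add: mat3_eq_iff forall_3 components)
  ultimately show ?thesis by simp
qed

lemma row_part: assumes X: "X \<in> B" shows "(X $ 3 $ 1) *\<^sub>C e 3 1 + (X $ 3 $ 2) *\<^sub>C e 3 2 \<in> B"
proof -
  let ?g = "e 1 1 + e 2 2"
  have "X ** ?g - ?g ** X ** ?g \<in> B" using X g by (simp add: B_closed)
  moreover have "X ** ?g - ?g ** X ** ?g = (X $ 3 $ 1) *\<^sub>C e 3 1 + (X $ 3 $ 2) *\<^sub>C e 3 2"
    by (simp add: mat3_eq_iff forall_3 components)
  ultimately show ?thesis by simp
qed

text \<open>
  The left hand side is the \<open>(3, 3)\<close> entry of a product in \<open>B\<close>.
\<close>
lemma row_column_orthogonal:
  assumes "X \<in> B" "Y \<in> B"
  shows "X $ 3 $ 1 * Y $ 1 $ 3 + X $ 3 $ 2 * Y $ 2 $ 3 = 0"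
  using corner_zero[OF B_closed(1)[OF assms]] corner_zero[OF assms(1)] by (simp add: components)

text \<open>
  If both off-diagonal Peirce components are nonzero, they are orthogonal lines
  and every matrix of \<open>B\<close> maps the plane spanned by the first and the third basis vector into
  the line spanned by the first one. Exchanging the last two
  basis vectors turns this into a triangular form with vanishing middle entry.
\<close>
lemma standardisable_if_row_and_column:
  assumes e13: "e 1 3 \<in> B" and X: "X \<in> B" "X $ 3 $ 1 \<noteq> 0 \<or> X $ 3 $ 2 \<noteq> 0"
  shows "standardisable B"
proof -
  have z31: "Z $ 3 $ 1 = 0" if "Z \<in> B" for Z
    using row_column_orthogonal[OF that e13] by (simp add: components)
  have "(X $ 3 $ 2) *\<^sub>C e 3 2 \<in> B" using row_part[OF X(1)] z31[OF X(1)] by simp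
  then have e32: "e 3 2 \<in> B" using X z31[OF X(1)] mem_if_scaled_mem by simp
  have z23: "Z $ 2 $ 3 = 0" if "Z \<in> B" for Z
    using row_column_orthogonal[OF e32 that] by (simp add: components)
  have z21: "Z $ 2 $ 1 = 0" if Z: "Z \<in> B" for Z
  proof -
    have "e 3 2 ** Z ** e 1 3 \<in> B" using Z e13 e32 by (intro B_closed)
    from corner_zero[OF this] show ?thesis by (simp add: components)
  qed
  let ?S = "e 1 1 + e 2 3 + e 3 2"
  have "?S ** ?S = mat 1" by (simp add: mat3_eq_iff forall_3 components mat_def)
  with B show ?thesis
  proof (rule standardisable_if_conjugate)
    assume B': "nonunital5 (conjugation ?S ?S ` B)"
    have "conjugation ?S ?S Z \<in> upper_vanishing 2" if "Z \<in> B" for Z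
      using z31[OF that] z23[OF that] z21[OF that] corner_zero[OF that]
      by (simp add: upper_vanishing_def upper_def conjugation_def components)
    then show "standardisable (conjugation ?S ?S ` B)"
      by (intro standardisable_if_subset[OF B'] disjI1 image_subsetI)
  qed
qed

text \<open>
  With a vanishing last row, only the upper left block still has to be made triangular; the
  lower triangular case is turned into the upper one by exchanging the first two basis vectors.
\<close>
lemma standardisable_if_corner_triangular:
  assumes r3: "\<And>X. X \<in> B \<Longrightarrow> X $ 3 $ 1 = 0 \<and> X $ 3 $ 2 = 0"
    and z: "(\<forall>X\<in>B. X $ 2 $ 1 = 0) \<or> (\<forall>X\<in>B. X $ 1 $ 2 = 0)"
  shows "standardisable B"
  using z
proof
  assume "\<forall>X\<in>B. X $ 2 $ 1 = 0"
  then show ?thesis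
    using r3 corner_zero
    by (intro standardisable_if_subset[OF B]) (auto simp: upper_vanishing_def upper_def)
next
  assume z12: "\<forall>X\<in>B. X $ 1 $ 2 = 0"
  let ?S = "e 1 2 + e 2 1 + e 3 3"
  have "?S ** ?S = mat 1" by (simp add: mat3_eq_iff forall_3 components mat_def)
  with B show ?thesis
  proof (rule standardisable_if_conjugate)
    assume B': "nonunital5 (conjugation ?S ?S ` B)"
    have "conjugation ?S ?S Z \<in> upper_vanishing 3" if "Z \<in> B" for Z
      using r3[OF that] z12 that corner_zero[OF that]
      by (simp add: upper_vanishing_def upper_def conjugation_def components)
    then show "standardisable (conjugation ?S ?S ` B)"
      by (intro standardisable_if_subset[OF B'] disjI2 image_subsetI)
  qed
qed

lemma not_all_upper_blocks:
  assumes "e 1 1 \<in> B" "e 1 2 \<in> B" "e 2 1 \<in> B" "e 2 2 \<in> B" "e 1 3 \<in> B" "e 2 3 \<in> B"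
  shows False
proof -
  let ?S = "{e 1 1, e 1 2, e 2 1, e 2 2, e 1 3, e 2 3}"
  have "?S \<subseteq> (\<lambda>(i, j). e i j) ` UNIV" by auto
  then have "\<not> mat3.dependent ?S" using mat3.independent_Basis mat3.independent_mono by blast
  then have "card ?S \<le> mat3.dim B" using assms by (intro mat3.independent_card_le_dim) auto
  moreover have "card ?S = 6" by (simp add: e_eq_iff)
  ultimately show False using B by (simp add: nonunital5_def)
qed

text \<open>
  A subalgebra of the full algebra of \<open>2\<close> by \<open>2\<close> matrices that contains the identity and one of \<open>e 2 1\<close>,
  \<open>e 2 2\<close> is triangular in the given basis unless it is everything. Everything is excluded by dimension.
\<close>
lemma standardisable_if_row_zero_aux:
  assumes r3: "\<And>X. X \<in> B \<Longrightarrow> X $ 3 $ 1 = 0 \<and> X $ 3 $ 2 = 0"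
    and col: "e 1 3 \<in> B" "e 2 3 \<in> B" and z: "e 2 1 \<in> B \<or> e 2 2 \<in> B"
  shows "standardisable B"
proof (rule ccontr)
  assume no: "\<not> standardisable B"
  obtain X where X: "X \<in> B" "X $ 2 $ 1 \<noteq> 0" using no standardisable_if_corner_triangular r3 by blast
  obtain Y where Y: "Y \<in> B" "Y $ 1 $ 2 \<noteq> 0" using no standardisable_if_corner_triangular r3 by blast
  have e22: "e 2 2 \<in> B"
  proof (rule disjE[OF z])
    assume e21: "e 2 1 \<in> B"
    have "e 2 1 ** Y - (Y $ 1 $ 1) *\<^sub>C e 2 1 - (Y $ 1 $ 3) *\<^sub>C e 2 3 \<in> B"
      using e21 Y col by (intro B_closed)
    moreover have "e 2 1 ** Y - (Y $ 1 $ 1) *\<^sub>C e 2 1 - (Y $ 1 $ 3) *\<^sub>C e 2 3 = (Y $ 1 $ 2) *\<^sub>C e 2 2"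
      by (simp add: mat3_eq_iff forall_3 components)
    ultimately show ?thesis using Y mem_if_scaled_mem by simp
  qed
  then have "(e 1 1 + e 2 2) - e 2 2 \<in> B" using g B_closed(3) by blast
  then have e11: "e 1 1 \<in> B" by simp
  have "e 2 2 ** X ** e 1 1 \<in> B" using e11 e22 X by (intro B_closed)
  moreover have "e 2 2 ** X ** e 1 1 = (X $ 2 $ 1) *\<^sub>C e 2 1"
    by (simp add: mat3_eq_iff forall_3 components)
  ultimately have e21: "e 2 1 \<in> B" using X mem_if_scaled_mem by simp
  have "e 1 1 ** Y ** e 2 2 \<in> B" using e11 e22 Y by (intro B_closed)
  moreover have "e 1 1 ** Y ** e 2 2 = (Y $ 1 $ 2) *\<^sub>C e 1 2"
    by (simp add: mat3_eq_iff forall_3 components)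
  ultimately have e12: "e 1 2 \<in> B" using Y mem_if_scaled_mem by simp
  show False using not_all_upper_blocks e11 e12 e21 e22 col by blast
qed

end

text \<open>
  Unless \<open>B\<close> is already upper triangular, it contains the whole last column above the corner. Then
  only three dimensions remain for the upper left block, so a nonzero matrix of \<open>B\<close> is
  concentrated in the second row of that block. A shear turns such a matrix, if it is not a multiple
  of \<open>e 2 1\<close>, into a multiple of \<open>e 2 2\<close>.
\<close>
lemma standardisable_if_row_zero:
  assumes B: "nonunital5 B" and g: "e 1 1 + e 2 2 \<in> B"
    and r3: "\<And>X. X \<in> B \<Longrightarrow> X $ 3 $ 1 = 0 \<and> X $ 3 $ 2 = 0"
    and e13: "e 1 3 \<in> B"
  shows "standardisable B"
proof (cases "\<forall>X\<in>B. X $ 2 $ 1 = 0")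
  case True
  then show ?thesis using standardisable_if_corner_triangular[OF B g] r3 by blast
next
  case False
  note closed = B_closed[OF B g]
  obtain X where X: "X \<in> B" "X $ 2 $ 1 \<noteq> 0" using False by blast
  have "X ** e 1 3 - (X $ 1 $ 1) *\<^sub>C e 1 3 \<in> B" using X e13 by (intro closed)
  moreover have "X ** e 1 3 - (X $ 1 $ 1) *\<^sub>C e 1 3 = (X $ 2 $ 1) *\<^sub>C e 2 3"
    using r3[OF X(1)] by (simp add: mat3_eq_iff forall_3 components)
  ultimately have e23: "e 2 3 \<in> B" using X mem_if_scaled_mem[OF B g] by simp
  have "mat3.subspace B" "mat3.dim B = 5" using B by (simp_all add: nonunital5_def subalgebra_def)
  from common_zero[OF this functional_component[of 1 1] functional_component[of 1 2]
      functional_component[of 1 3] functional_component[of 2 3]]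
  obtain Y where Y: "Y \<in> B" "Y \<noteq> 0" "Y $ 1 $ 1 = 0" "Y $ 1 $ 2 = 0" "Y $ 1 $ 3 = 0" "Y $ 2 $ 3 = 0"
    by blast
  have Y_eq: "Y = (Y $ 2 $ 1) *\<^sub>C e 2 1 + (Y $ 2 $ 2) *\<^sub>C e 2 2"
    using Y r3[OF Y(1)] corner_zero[OF B g Y(1)] by (simp add: mat3_eq_iff forall_3 components)
  show ?thesis
  proof (cases "Y $ 2 $ 2 = 0")
    case True
    then have "Y $ 2 $ 1 \<noteq> 0" "(Y $ 2 $ 1) *\<^sub>C e 2 1 \<in> B" using Y Y_eq by auto
    then have "e 2 1 \<in> B" using mem_if_scaled_mem[OF B g] by blast
    then show ?thesis using standardisable_if_row_zero_aux[OF B g r3 e13 e23] by blast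
  next
    case False
    \<comment> \<open>The shear fixes the second basis vector and subtracts \<open>c\<close> times the second entry of the
        row \<open>(Y $ 2 $ 1, Y $ 2 $ 2)\<close> from the first.\<close>
    define c where "c = Y $ 2 $ 1 / Y $ 2 $ 2"
    let ?P = "E + c *\<^sub>C e 2 1" and ?Q = "E - c *\<^sub>C e 2 1"
    let ?f = "conjugation ?P ?Q"
    have PQ: "?P ** ?Q = mat 1" by (simp add: mat3_eq_iff forall_3 components mat_def)
    show ?thesis using B PQ
    proof (rule standardisable_if_conjugate)
      assume B': "nonunital5 (?f ` B)"
      have "?f (e 1 1 + e 2 2) = e 1 1 + e 2 2"
        by (simp add: conjugation_def mat3_eq_iff forall_3 components)
      then have g': "e 1 1 + e 2 2 \<in> ?f ` B" using g by (metis imageI)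
      have r3': "Z $ 3 $ 1 = 0 \<and> Z $ 3 $ 2 = 0" if "Z \<in> ?f ` B" for Z
        using that r3 by (auto simp: conjugation_def components)
      have "?f (e 2 3) = e 2 3"
        by (simp add: conjugation_def mat3_eq_iff forall_3 components)
      then have e23': "e 2 3 \<in> ?f ` B" using e23 by (metis imageI)
      have "e 1 3 - c *\<^sub>C e 2 3 \<in> B" using e13 e23 by (intro closed)
      moreover have "?f (e 1 3 - c *\<^sub>C e 2 3) = e 1 3"
        by (simp add: conjugation_def mat3_eq_iff forall_3 components)
      ultimately have e13': "e 1 3 \<in> ?f ` B" by (metis imageI)
      have "(1 / Y $ 2 $ 2) *\<^sub>C Y \<in> B" using Y by (intro closed)
      moreover have "?f ((1 / Y $ 2 $ 2) *\<^sub>C Y) = e 2 2"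
        using False Y_eq r3[OF Y(1)] Y corner_zero[OF B g Y(1)]
        by (simp add: conjugation_def mat3_eq_iff forall_3 components c_def)
      ultimately have "e 2 2 \<in> ?f ` B" by (metis imageI)
      then show "standardisable (?f ` B)"
        using standardisable_if_row_zero_aux[OF B' g' r3' e13' e23'] by blast
    qed
  qed
qed

text \<open>
  A nonzero vector in the last column can be moved to the first basis vector by a change
  of basis in the upper left block, which fixes the idempotent. Then the cases of a nonzero and of a
  zero last row apply.
\<close>
lemma standardisable_if_column:
  assumes B: "nonunital5 B" and g: "e 1 1 + e 2 2 \<in> B"
    and X: "X \<in> B" "X $ 1 $ 3 \<noteq> 0 \<or> X $ 2 $ 3 \<noteq> 0"
  shows "standardisable B"
proof -
  let ?u = "X $ 1 $ 3" and ?v = "X $ 2 $ 3"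
  have "\<exists>P Q. P ** Q = mat 1 \<and> conjugation P Q (e 1 1 + e 2 2) = e 1 1 + e 2 2 \<and>
    conjugation P Q (?u *\<^sub>C e 1 3 + ?v *\<^sub>C e 2 3) = e 1 3"
  proof (cases "?u = 0")
    case True
    then have "?v \<noteq> 0" using X by blast
    with True show ?thesis
      by (intro exI[of _ "e 2 1 + (1 / ?v) *\<^sub>C e 1 2 + e 3 3"] exI[of _ "e 1 2 + ?v *\<^sub>C e 2 1 + e 3 3"])
        (simp add: conjugation_def mat3_eq_iff forall_3 components mat_def)
  next
    case False
    then show ?thesis
      by (intro exI[of _ "(1 / ?u) *\<^sub>C e 1 1 - (?v / ?u) *\<^sub>C e 2 1 + e 2 2 + e 3 3"]
          exI[of _ "?u *\<^sub>C e 1 1 + ?v *\<^sub>C e 2 1 + e 2 2 + e 3 3"])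
        (simp add: conjugation_def mat3_eq_iff forall_3 components mat_def)
  qed
  then obtain P Q where PQ: "P ** Q = mat 1" and fg: "conjugation P Q (e 1 1 + e 2 2) = e 1 1 + e 2 2"
    and fX: "conjugation P Q (?u *\<^sub>C e 1 3 + ?v *\<^sub>C e 2 3) = e 1 3" by blast
  show ?thesis using B PQ
  proof (rule standardisable_if_conjugate)
    let ?B = "conjugation P Q ` B"
    assume B': "nonunital5 ?B"
    have g': "e 1 1 + e 2 2 \<in> ?B" using fg g by (metis imageI)
    have e13: "e 1 3 \<in> ?B" using fX column_part[OF B g X(1)] by (metis imageI)
    show "standardisable ?B"
    proof (cases "\<exists>Z\<in>?B. Z $ 3 $ 1 \<noteq> 0 \<or> Z $ 3 $ 2 \<noteq> 0")
      case True
      then obtain Z where "Z \<in> ?B" "Z $ 3 $ 1 \<noteq> 0 \<or> Z $ 3 $ 2 \<noteq> 0" by metis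
      then show ?thesis by (rule standardisable_if_row_and_column[OF B' g' e13])
    next
      case False
      then have "Z $ 3 $ 1 = 0 \<and> Z $ 3 $ 2 = 0" if "Z \<in> ?B" for Z using that by metis
      then show ?thesis by (rule standardisable_if_row_zero[OF B' g' _ e13])
    qed
  qed
qed

text \<open>
  The upper left block has only four dimensions, so the last row or the last column of \<open>B\<close> is
  nonzero. Transposition exchanges the two.
\<close>
lemma standardisable_if_idempotent:
  assumes B: "nonunital5 B" and g: "e 1 1 + e 2 2 \<in> B"
  shows "standardisable B"
proof (cases "\<exists>X\<in>B. X $ 1 $ 3 \<noteq> 0 \<or> X $ 2 $ 3 \<noteq> 0")
  case True
  then show ?thesis using standardisable_if_column[OF B g] by metis
next
  case False
  have "mat3.subspace B" "mat3.dim B = 5" using B by (simp_all add: nonunital5_def subalgebra_def)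
  from common_zero[OF this functional_component[of 1 1] functional_component[of 1 2]
      functional_component[of 2 1] functional_component[of 2 2]]
  obtain Y where Y: "Y \<in> B" "Y \<noteq> 0" "Y $ 1 $ 1 = 0" "Y $ 1 $ 2 = 0" "Y $ 2 $ 1 = 0" "Y $ 2 $ 2 = 0"
    by blast
  have "Y $ 3 $ 1 \<noteq> 0 \<or> Y $ 3 $ 2 \<noteq> 0"
    using False Y corner_zero[OF B g Y(1)] by (auto simp: mat3_eq_iff forall_3)
  then have Yt: "transpose Y \<in> transpose ` B" "transpose Y $ 1 $ 3 \<noteq> 0 \<or> transpose Y $ 2 $ 3 \<noteq> 0"
    using Y by (auto simp: transpose_def)
  have "transpose (e 1 1 + e 2 2) = e 1 1 + e 2 2"
    by (simp add: mat3_eq_iff forall_3 transpose_def components)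
  then have gt: "e 1 1 + e 2 2 \<in> transpose ` B" using g by (metis imageI)
  have "standardisable (transpose ` B)"
    using standardisable_if_column[OF nonunital5_symmetry_image[OF symmetry_transpose B] gt Yt] .
  then show ?thesis using symmetry_transpose standardisable_symmetry_image by blast
qed

section \<open>Reduction of the five-dimensional summand\<close>

text \<open>
  The second elementary symmetric function of the eigenvalues: the sum of the principal \<open>2\<close> by \<open>2\<close> minors.
\<close>
definition minor_sum :: "mat3 \<Rightarrow> complex"
  where "minor_sum X = X $ 1 $ 1 * X $ 2 $ 2 - X $ 1 $ 2 * X $ 2 $ 1
    + X $ 1 $ 1 * X $ 3 $ 3 - X $ 1 $ 3 * X $ 3 $ 1 + X $ 2 $ 2 * X $ 3 $ 3 - X $ 2 $ 3 * X $ 3 $ 2"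

lemma cayley_hamilton: "X ** X ** X - trace X *\<^sub>C (X ** X) + minor_sum X *\<^sub>C X = det X *\<^sub>C E"
  unfolding mat3_eq_iff forall_3
  by (simp add: components trace_def sum_3 minor_sum_def det_3) algebra

text \<open>
  Polarisation: where \<open>minor_sum\<close> vanishes, the trace form is the product of the traces.
\<close>
lemma minor_sum_add: "minor_sum (X + Y) = minor_sum X + minor_sum Y + trace X * trace Y - trace (X ** Y)"
  by (simp add: minor_sum_def trace_def sum_3 components algebra_simps)

text \<open>
  An invertible matrix generates the identity, by Cayley--Hamilton, as a polynomial in it without constant term.
\<close>
lemma nonunital5_singular:
  assumes B: "nonunital5 B" and X: "X \<in> B"
  shows "det X = 0"
proof (rule ccontr)
  assume d: "det X \<noteq> 0"
  have "X ** X ** X - trace X *\<^sub>C (X ** X) + minor_sum X *\<^sub>C X \<in> B"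
    using B X by (simp add: nonunital5_def subalgebra_closed)
  then have "(1 / det X) *\<^sub>C (det X *\<^sub>C E) \<in> B"
    unfolding cayley_hamilton using B by (simp only: nonunital5_def subalgebra_closed)
  then show False using B d by (simp add: nonunital5_def)
qed

lemma functional_trace: "functional trace"
  by (simp add: functional_def trace_def sum_3 components algebra_simps)

lemma sum_UNIV_distinct:
  fixes f :: "'a::finite \<Rightarrow> 'b::comm_monoid_add"
  assumes "UNIV = {p, q, r}" "q \<noteq> p" "r \<noteq> p" "q \<noteq> r"
  shows "sum f UNIV = f p + f q + f r"
proof -
  have "sum f UNIV = sum f {p, q, r}" by (rule arg_cong[OF assms(1)])
  also have "\<dots> = f p + f q + f r"
    using assms(2-4) assms(2,3)[symmetric] by (simp add: add.assoc)
  finally show ?thesis .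
qed

text \<open>
  In the application \<open>S\<close> is a vector space, and \<open>l i\<close> and \<open>u i\<close> are the entries below the diagonal and
  their mirror images above it. Let \<open>K\<close> be the subspace of \<open>S\<close> on which all \<open>l i\<close> vanish.
  By \<open>nz\<close>, the \<open>u i\<close> embed \<open>K\<close> into a three-dimensional space, and by \<open>pair\<close> the image of \<open>S\<close> under \<open>l\<close> is orthogonal to that of \<open>K\<close>. So
  \<open>dim S = dim K + dim (l ` S)\<close> is at most three, while \<open>ex\<close> expresses that it is at least four.
  The proof carries out this count by elimination: each nonzero element of \<open>K\<close> with a pivot at \<open>p\<close>
  makes \<open>l p\<close> redundant, which frees one functional for producing the next element of \<open>K\<close>.
\<close>
lemma isotropic_pairing_contradiction:
  fixes S :: "mat3 set" and l u :: "3 \<Rightarrow> mat3 \<Rightarrow> complex"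
  assumes pair: "\<And>X Y. X \<in> S \<Longrightarrow> Y \<in> S \<Longrightarrow> \<forall>i. l i Y = 0 \<Longrightarrow> (\<Sum>i\<in>UNIV. l i X * u i Y) = 0"
    and nz: "\<And>X. X \<in> S \<Longrightarrow> \<forall>i. l i X = 0 \<and> u i X = 0 \<Longrightarrow> X = 0"
    and ex: "\<And>f g h. f \<in> range l \<union> range u \<Longrightarrow> g \<in> range l \<union> range u \<Longrightarrow> h \<in> range l \<union> range u
      \<Longrightarrow> \<exists>X\<in>S. X \<noteq> 0 \<and> f X = 0 \<and> g X = 0 \<and> h X = 0"
  shows False
proof -
  obtain N where N: "N \<in> S" "N \<noteq> 0" "\<forall>i. l i N = 0"
    using ex[of "l 1" "l 2" "l 3"] by (auto simp: forall_3)
  then obtain p where p: "u p N \<noteq> 0" using nz by blast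
  obtain q' r' where qr': "UNIV = {p, q', r'}" "q' \<noteq> p" "r' \<noteq> p" "q' \<noteq> r'"
  proof -
    have "UNIV = {1, 2, 3 :: 3}" "UNIV = {2, 1, 3 :: 3}" "UNIV = {3, 1, 2 :: 3}"
      using exhaust_3 by auto
    moreover have "p = 1 \<or> p = 2 \<or> p = 3" by (rule exhaust_3)
    ultimately show ?thesis
      using that[of 2 3] that[of 1 3] that[of 1 2] by (elim disjE) simp_all
  qed
  have lp: "l p X = 0" if "X \<in> S" "l q' X = 0" "l r' X = 0" for X
  proof -
    show ?thesis using pair[OF that(1) N(1,3)] that p by (simp add: sum_UNIV_distinct[OF qr'])
  qed
  obtain N' where N': "N' \<in> S" "N' \<noteq> 0" "l q' N' = 0" "l r' N' = 0" "u p N' = 0"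
    using ex[of "l q'" "l r'" "u p"] by auto
  have lN': "\<forall>i. l i N' = 0"
  proof
    fix i have "i \<in> {p, q', r'}" using qr'(1) by blast
    then show "l i N' = 0" using lp N' by auto
  qed
  then obtain q where q: "u q N' \<noteq> 0" using nz N' by blast
  then have "q \<noteq> p" using N' by auto
  moreover have "q \<in> {p, q', r'}" using qr'(1) by blast
  moreover have "{p, q', r'} = {p, r', q'}" by blast
  ultimately obtain r where qr: "UNIV = {p, q, r}" "q \<noteq> p" "r \<noteq> p" "q \<noteq> r"
    using qr' by auto
  have ex_i: "i = p \<or> i = q \<or> i = r" for i using qr(1) by blast
  have lpq: "l p X = 0" if "X \<in> S" "l q X = 0" "l r X = 0" for X
  proof -
    show ?thesis using pair[OF that(1) N(1,3)] that p by (simp add: sum_UNIV_distinct[OF qr])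
  qed
  have lq: "l q X = 0" if "X \<in> S" "l r X = 0" for X
  proof -
    show ?thesis using pair[OF that(1) N'(1) lN'] that q N' by (simp add: sum_UNIV_distinct[OF qr])
  qed
  have l0: "\<forall>i. l i X = 0" if "X \<in> S" "l r X = 0" for X
    using lpq lq that ex_i by metis
  obtain N'' where N'': "N'' \<in> S" "N'' \<noteq> 0" "l r N'' = 0" "u p N'' = 0" "u q N'' = 0"
    using ex[of "l r" "u p" "u q"] by auto
  have lN'': "\<forall>i. l i N'' = 0" using l0 N'' by blast
  have ur: "u r N'' \<noteq> 0" using nz[OF N''(1)] lN'' N'' ex_i by metis
  have lr: "l r X = 0" if "X \<in> S" for X
  proof -
    show ?thesis using pair[OF that N''(1) lN''] N'' ur by (simp add: sum_UNIV_distinct[OF qr])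
  qed
  obtain Z where Z: "Z \<in> S" "Z \<noteq> 0" "u p Z = 0" "u q Z = 0" "u r Z = 0"
    using ex[of "u p" "u q" "u r"] by auto
  then have "\<forall>i. l i Z = 0 \<and> u i Z = 0" using l0 lr ex_i by metis
  then show False using nz Z by blast
qed

text \<open>
  Otherwise the characteristic polynomial of a traceless element of \<open>B\<close> is a pure cube, so that an
  upper triangular one is strictly upper triangular, and two traceless elements are orthogonal for
  the trace form. Both facts together are what \<open>isotropic_pairing_contradiction\<close> excludes.
\<close>
lemma nonunital5_minor_sum_nonzero:
  assumes B: "nonunital5 B"
  shows "\<exists>X\<in>B. minor_sum X \<noteq> 0"
proof (rule ccontr)
  assume none: "\<not> (\<exists>X\<in>B. minor_sum X \<noteq> 0)"
  have ms: "minor_sum X = 0" if "X \<in> B" for X using none that by blast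
  have sub: "mat3.subspace B" "mat3.dim B = 5" "subalgebra B"
    using B by (simp_all add: nonunital5_def subalgebra_def)
  define S where "S = {X \<in> B. trace X = 0}"
  have diag: "Y $ 1 $ 1 = 0 \<and> Y $ 2 $ 2 = 0 \<and> Y $ 3 $ 3 = 0" if Y: "Y \<in> S" "upper Y" for Y
  proof -
    have "Y $ 1 $ 1 + Y $ 2 $ 2 + Y $ 3 $ 3 = 0" using Y by (simp add: S_def trace_def sum_3)
    moreover have "Y $ 1 $ 1 * Y $ 2 $ 2 + Y $ 1 $ 1 * Y $ 3 $ 3 + Y $ 2 $ 2 * Y $ 3 $ 3 = 0"
      using ms[of Y] Y by (simp add: S_def minor_sum_def upper_def)
    moreover have "Y $ 1 $ 1 * Y $ 2 $ 2 * Y $ 3 $ 3 = 0"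
      using nonunital5_singular[OF B, of Y] Y by (simp add: S_def det_3 upper_def)
    ultimately show ?thesis by (auto simp: add_eq_0_iff)
  qed
  have orth: "trace (X ** Y) = 0" if "X \<in> S" "Y \<in> S" for X Y
    using minor_sum_add[of X Y] ms that sub by (simp add: S_def subalgebra_add)
  \<comment> \<open>Row and column of the three positions below the diagonal.\<close>
  define ro co :: "3 \<Rightarrow> 3" where "ro i = (if i = 1 then 2 else 3)" and "co i = (if i = 3 then 2 else 1)" for i
  define l u :: "3 \<Rightarrow> mat3 \<Rightarrow> complex" where "l i X = X $ ro i $ co i" and "u i X = X $ co i $ ro i" for i X
  have up: "(\<forall>i. l i X = 0) \<longleftrightarrow> upper X" for X
    by (simp add: forall_3 l_def upper_def ro_def co_def)
  show False
  proof (rule isotropic_pairing_contradiction)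
    fix X Y assume XY: "X \<in> S" "Y \<in> S" "\<forall>i. l i Y = 0"
    have Y: "upper Y" using XY up by blast
    show "(\<Sum>i\<in>UNIV. l i X * u i Y) = 0"
      using orth[OF XY(1,2)] diag[OF XY(2) Y] Y
      by (simp add: sum_3 l_def u_def ro_def co_def trace_def sum_3 components upper_def add.assoc)
  next
    fix X assume X: "X \<in> S" "\<forall>i. l i X = 0 \<and> u i X = 0"
    then have "upper X" using up by blast
    with diag[OF X(1)] X(2) show "X = 0"
      by (simp add: mat3_eq_iff forall_3 u_def ro_def co_def upper_def)
  next
    fix f g h
    assume fgh: "f \<in> range l \<union> range u" "g \<in> range l \<union> range u" "h \<in> range l \<union> range u"
    have "functional k" if "k \<in> range l \<union> range u" for k
    proof -
      have "functional (l i)" "functional (u i)" for i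
        unfolding l_def u_def by (rule functional_component)+
      then show ?thesis using that by blast
    qed
    with fgh have "functional f" "functional g" "functional h" by blast+
    from common_zero[OF sub(1,2) functional_trace this]
    show "\<exists>X\<in>S. X \<noteq> 0 \<and> f X = 0 \<and> g X = 0 \<and> h X = 0" unfolding S_def by blast
  qed
qed

text \<open>
  Vanishing minors say that \<open>H\<close> is a column times a row, and trace one that the row takes the value
  one on the column. So the column completes a basis of the kernel of the row to a basis of the space.
\<close>
lemma rank_one_idempotent_diagonalisable:
  assumes minors: "\<And>i j k l. H $ i $ j * H $ k $ l = H $ i $ l * H $ k $ j"
    and t: "trace H = 1"
  obtains P Q where "P ** Q = mat 1" "conjugation P Q H = e 3 3"
proof -
  have H_idem: "H $ i $ 1 * H $ 1 $ j + H $ i $ 2 * H $ 2 $ j + H $ i $ 3 * H $ 3 $ j = H $ i $ j" for i j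
  proof -
    have "H $ i $ 1 * H $ 1 $ j + H $ i $ 2 * H $ 2 $ j + H $ i $ 3 * H $ 3 $ j = H $ i $ j * trace H"
      using minors[of i 1 1 j] minors[of i 2 2 j] minors[of i 3 3 j]
      by (simp add: trace_def sum_3 algebra_simps)
    then show ?thesis using t by simp
  qed
  have "\<exists>Q. det Q \<noteq> 0 \<and> H ** Q = Q ** e 3 3"
  proof -
    have "\<exists>k. H $ k $ k \<noteq> 0"
      by (rule ccontr) (use t in \<open>simp add: trace_def sum_3\<close>)
    then obtain k where k: "H $ k $ k \<noteq> 0" by blast
    define w where "w i = H $ i $ k" for i
    define v where "v j = H $ k $ j" for j
    have Hw: "H $ i $ 1 * w 1 + H $ i $ 2 * w 2 + H $ i $ 3 * w 3 = w i" for i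
      using H_idem[of i k] by (simp add: w_def)
    have Hv: "H $ i $ j * v l = H $ i $ l * v j" for i j l
      using minors[of i j k l] by (simp add: v_def)
    have vw: "v 1 * w 1 + v 2 * w 2 + v 3 * w 3 = v k"
      using H_idem[of k k] by (simp add: v_def w_def)
    have vk: "v k \<noteq> 0" using k by (simp add: v_def)
    \<comment> \<open>Up to sign, the first two columns have \<open>v i\<close> at position \<open>j\<close> and \<open>- v j\<close> at position \<open>i\<close>, and so lie
        in the kernel of the row \<open>v\<close>; the pairs with \<open>i = k\<close> give independent columns because
        \<open>v k\<close> is not zero.\<close>
    let ?Q3 = "v 3 *\<^sub>C e 1 1 - v 1 *\<^sub>C e 3 1 + v 3 *\<^sub>C e 2 2 - v 2 *\<^sub>C e 3 2
      + w 1 *\<^sub>C e 1 3 + w 2 *\<^sub>C e 2 3 + w 3 *\<^sub>C e 3 3"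
    let ?Q2 = "v 2 *\<^sub>C e 1 1 - v 1 *\<^sub>C e 2 1 + v 2 *\<^sub>C e 3 2 - v 3 *\<^sub>C e 2 2
      + w 1 *\<^sub>C e 1 3 + w 2 *\<^sub>C e 2 3 + w 3 *\<^sub>C e 3 3"
    let ?Q1 = "v 1 *\<^sub>C e 2 1 - v 2 *\<^sub>C e 1 1 + v 1 *\<^sub>C e 3 2 - v 3 *\<^sub>C e 1 2
      + w 1 *\<^sub>C e 1 3 + w 2 *\<^sub>C e 2 3 + w 3 *\<^sub>C e 3 3"
    have Q: "H ** ?Q3 = ?Q3 ** e 3 3" "H ** ?Q2 = ?Q2 ** e 3 3" "H ** ?Q1 = ?Q1 ** e 3 3"
      unfolding mat3_eq_iff using Hw Hv by (simp_all add: forall_3 components algebra_simps)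
    have "det ?Q3 = v 3 * v k" "det ?Q2 = - (v 2 * v k)" "det ?Q1 = v 1 * v k"
      unfolding vw[symmetric] by (simp_all add: det_3 components algebra_simps)
    then have "k = 3 \<Longrightarrow> det ?Q3 \<noteq> 0" "k = 2 \<Longrightarrow> det ?Q2 \<noteq> 0" "k = 1 \<Longrightarrow> det ?Q1 \<noteq> 0"
      using vk by auto
    then show ?thesis using Q exhaust_3[of k] by blast
  qed
  then obtain Q where Q: "det Q \<noteq> 0" "H ** Q = Q ** e 3 3" by blast
  then obtain P where P: "P ** Q = mat 1"
    using invertible_det_nz[of Q] invertible_left_inverse by blast
  have "conjugation P Q H = P ** (H ** Q)" by (simp add: conjugation_def matrix_mul_assoc)
  also have "\<dots> = e 3 3" using P by (simp add: Q(2) matrix_mul_assoc)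
  finally show ?thesis using that P by blast
qed

text \<open>
  For singular \<open>X\<close> the adjugate \<open>X\<^sup>2 - trace X X + minor_sum X E\<close> has rank at most one and trace \<open>minor_sum X\<close>.
  Divided by its trace it is the idempotent of rank one complementary to a polynomial in \<open>X\<close> that
  lies in \<open>B\<close>.
\<close>
lemma nonunital5_standardisable:
  assumes B: "nonunital5 B"
  shows "standardisable B"
proof -
  obtain X where X: "X \<in> B" "minor_sum X \<noteq> 0" using nonunital5_minor_sum_nonzero[OF B] by blast
  define G where "G = (1 / minor_sum X) *\<^sub>C (trace X *\<^sub>C X - X ** X)"
  have G: "G \<in> B" unfolding G_def using B X by (simp add: nonunital5_def subalgebra_closed)
  define K where "K = X ** X - trace X *\<^sub>C X + minor_sum X *\<^sub>C E"
  have K_minors: "K $ i $ j * K $ k $ l = K $ i $ l * K $ k $ j" for i j k l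
  proof -
    have "\<forall>i j k l. K $ i $ j * K $ k $ l = K $ i $ l * K $ k $ j"
      using nonunital5_singular[OF B X(1)] unfolding forall_3 det_3
      by (simp add: K_def components trace_def sum_3 minor_sum_def) algebra
    then show ?thesis by blast
  qed
  have H: "E - G = (1 / minor_sum X) *\<^sub>C K"
    using X by (simp add: G_def K_def mat3_eq_iff components field_simps)
  have "trace K = minor_sum X"
    by (simp add: K_def trace_def sum_3 minor_sum_def components algebra_simps)
  then have "trace (E - G) = 1"
    unfolding H using X by (simp add: trace_def sum_3 components field_simps)
  moreover have "(E - G) $ i $ j * (E - G) $ k $ l = (E - G) $ i $ l * (E - G) $ k $ j" for i j k l
    unfolding H using K_minors[of i j k l] by (simp add: components)
  ultimately obtain P Q where PQ: "P ** Q = mat 1" and f: "conjugation P Q (E - G) = e 3 3"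
    using rank_one_idempotent_diagonalisable by metis
  interpret f: Vector_Spaces.linear mscale mscale "conjugation P Q" by (rule conjugation_linear)
  have "conjugation P Q E = E" using automorphism_conjugation[OF PQ] by (simp add: automorphism_def)
  with f have "conjugation P Q G = E - e 3 3" by (simp add: f.diff algebra_simps)
  also have "\<dots> = e 1 1 + e 2 2" by (simp add: mat3_eq_iff forall_3 components)
  finally have g: "e 1 1 + e 2 2 \<in> conjugation P Q ` B" using G by (metis imageI)
  from B PQ show ?thesis
    by (rule standardisable_if_conjugate) (rule standardisable_if_idempotent[OF _ g])
qed

section \<open>Complements of the upper triangular matrices\<close>

text \<open>
  The subalgebra is a complement of the upper triangular matrices up to the scalars, which both contain.
\<close>
definition transversal :: "mat3 set \<Rightarrow> bool"
  where "transversal A \<longleftrightarrow> subalgebra A \<and> E \<in> A \<and>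
    (\<forall>X\<in>A. upper X \<longrightarrow> X = (X $ 1 $ 1) *\<^sub>C E) \<and> (\<forall>X. \<exists>Y\<in>A. upper (X - Y))"

text \<open>
  A scalar correction moves any upper triangular element of \<open>A\<close> into the other summand.
\<close>
lemma transversal_if_complement:
  assumes A: "subalgebra A" "E \<in> A" and AB: "direct_decomposition A (upper_vanishing k)"
  shows "transversal A"
proof -
  have "X = (X $ 1 $ 1) *\<^sub>C E" if X: "X \<in> A" "upper X" for X
  proof -
    let ?Y = "X - (X $ k $ k) *\<^sub>C E"
    have "?Y \<in> A" using A X by (simp add: subalgebra_closed)
    moreover have "?Y \<in> upper_vanishing k"
      using X by (simp add: upper_vanishing_def upper_def components)
    ultimately have "?Y = 0" using AB unfolding direct_decomposition_def by blast
    then have X_eq: "X = (X $ k $ k) *\<^sub>C E" by simp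
    have "X $ 1 $ 1 = X $ k $ k" by (subst X_eq) (simp add: components)
    with X_eq show ?thesis by simp
  qed
  moreover have "\<exists>Y\<in>A. upper (X - Y)" for X
  proof -
    obtain a b where "a \<in> A" "b \<in> upper_vanishing k" "X = a + b"
      using AB unfolding direct_decomposition_def by blast
    then show ?thesis by (intro bexI[of _ a]) (simp_all add: upper_vanishing_def)
  qed
  ultimately show ?thesis using A by (simp add: transversal_def)
qed

lemma transversal_conjugation:
  assumes A: "transversal A" and f: "upper_conjugation_map f"
  shows "transversal (f ` A)"
proof -
  obtain P Q where u: "upper P" "upper Q" and PQ: "P ** Q = mat 1"
    and f: "f = conjugation P Q"
    using f unfolding upper_conjugation_map_def by blast
  have QP: "Q ** P = mat 1" using PQ matrix_left_right_inverse by blast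
  interpret f: Vector_Spaces.linear mscale mscale f
    unfolding f by (rule conjugation_linear)
  have aut: "automorphism f" unfolding f by (rule automorphism_conjugation[OF PQ])
  then have fE: "f E = E" by (simp add: automorphism_def)
  have "subalgebra (f ` A)"
    using A aut subalgebra_automorphism_image by (simp add: transversal_def)
  moreover have "E \<in> f ` A"
    using A fE by (metis imageI transversal_def)
  moreover have "f X = (f X $ 1 $ 1) *\<^sub>C E" if "X \<in> A" "upper (f X)" for X
  proof -
    have "upper (conjugation Q P (f X))" using that u by (intro upper_conjugation)
    then have "upper X" by (simp add: f conjugation_inverse[OF QP])
    then have X: "X = (X $ 1 $ 1) *\<^sub>C E" using A that by (simp add: transversal_def)
    have "f X = (X $ 1 $ 1) *\<^sub>C E" by (subst X) (simp add: f.scale fE)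
    then show ?thesis by (simp add: components)
  qed
  moreover have "\<exists>Y\<in>f ` A. upper (X - Y)" for X
  proof -
    obtain Y where Y: "Y \<in> A" "upper (conjugation Q P X - Y)"
      using A unfolding transversal_def by blast
    have "upper (f (conjugation Q P X - Y))" using Y u unfolding f by (intro upper_conjugation)
    then have "upper (X - f Y)" by (simp only: f.diff) (simp add: f conjugation_inverse[OF PQ])
    then show ?thesis using Y by blast
  qed
  ultimately show ?thesis by (auto simp: transversal_def)
qed

text \<open>
  The normalisation \<open>Y $ k $ k = 0\<close> uses up the freedom of adding a scalar, so that \<open>Y\<close> is unique by the next lemma.
\<close>
lemma transversal_obtains_lower:
  assumes "transversal A"
  obtains Y where "Y \<in> A" "Y $ 2 $ 1 = r" "Y $ 3 $ 1 = s" "Y $ 3 $ 2 = t" "Y $ k $ k = 0"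
proof -
  obtain Z where Z: "Z \<in> A" "upper (r *\<^sub>C e 2 1 + s *\<^sub>C e 3 1 + t *\<^sub>C e 3 2 - Z)"
    using assms unfolding transversal_def by blast
  let ?Y = "Z - (Z $ k $ k) *\<^sub>C E"
  have "?Y \<in> A" using Z assms by (simp add: transversal_def subalgebra_closed)
  moreover have "?Y $ 2 $ 1 = r" "?Y $ 3 $ 1 = s" "?Y $ 3 $ 2 = t" "?Y $ k $ k = 0"
    using Z by (simp_all add: upper_def components)
  ultimately show ?thesis using that by blast
qed

lemma transversal_upper_eq_0:
  assumes "transversal A" "X \<in> A" "upper X" "X $ k $ k = 0"
  shows "X = 0"
proof -
  have X: "X = (X $ 1 $ 1) *\<^sub>C E" using assms by (simp add: transversal_def)
  have "X $ k $ k = X $ 1 $ 1" by (subst X) (simp add: components)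
  then show ?thesis using X assms by simp
qed

text \<open>
  The generator \<open>z\<close> may have an arbitrary \<open>(3, 1)\<close> entry because some of the listed
  algebras are spanned by \<open>b + c\<close> instead of \<open>c\<close>.
\<close>
lemma transversal_eq_span:
  assumes A: "transversal A" and m: "x \<in> A" "y \<in> A" "z \<in> A"
    and x: "x $ 2 $ 1 = 1" "x $ 3 $ 1 = 0" "x $ 3 $ 2 = 0"
    and y: "y $ 2 $ 1 = 0" "y $ 3 $ 1 = 1" "y $ 3 $ 2 = 0"
    and z: "z $ 2 $ 1 = 0" "z $ 3 $ 2 = 1"
  shows "A = mat3.span {E, x, y, z}"
proof
  have "mat3.subspace A" "E \<in> A" using A by (auto simp: transversal_def subalgebra_def)
  then show "mat3.span {E, x, y, z} \<subseteq> A" using m by (intro mat3.span_minimal) auto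
  show "A \<subseteq> mat3.span {E, x, y, z}"
  proof
    fix X assume X: "X \<in> A"
    let ?q = "X $ 2 $ 1" and ?s = "X $ 3 $ 2"
    let ?r = "X $ 3 $ 1 - ?s * z $ 3 $ 1"
    define D where "D = X - ?q *\<^sub>C x - ?r *\<^sub>C y - ?s *\<^sub>C z"
    have "D \<in> A" using A X m by (simp add: D_def transversal_def subalgebra_closed)
    moreover have "upper D" by (simp add: D_def upper_def components x y z)
    ultimately have "D = (D $ 1 $ 1) *\<^sub>C E" using A by (simp add: transversal_def)
    then have "X = (D $ 1 $ 1) *\<^sub>C E + ?q *\<^sub>C x + ?r *\<^sub>C y + ?s *\<^sub>C z"
      unfolding D_def by (simp add: algebra_simps)
    then show "X \<in> mat3.span {E, x, y, z}" unfolding span4_iff by blast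
  qed
qed

text \<open>
  Let \<open>X\<close> be the element of \<open>A\<close> whose only nonzero entry below the diagonal is \<open>X $ 2 $ 1 = 1\<close>,
  normalised to a vanishing last row. Then \<open>X\<^sup>2\<close> has the same shape, hence is a multiple of \<open>X\<close>, which
  leaves only a column times a row.
\<close>
lemma transversal_rank_one:
  assumes A: "transversal A"
  obtains X \<alpha> \<beta> \<gamma> where "X \<in> A"
    "X = \<alpha> *\<^sub>C e 1 1 + (\<alpha> * \<beta>) *\<^sub>C e 1 2 + (\<alpha> * \<gamma>) *\<^sub>C e 1 3 + e 2 1 + \<beta> *\<^sub>C e 2 2 + \<gamma> *\<^sub>C e 2 3"
proof -
  obtain X where X: "X \<in> A" "X $ 2 $ 1 = 1" "X $ 3 $ 1 = 0" "X $ 3 $ 2 = 0" "X $ 3 $ 3 = 0"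
    using transversal_obtains_lower[OF A] by blast
  let ?D = "X ** X - (X $ 1 $ 1 + X $ 2 $ 2) *\<^sub>C X"
  have "?D \<in> A" using X A by (simp add: transversal_def subalgebra_closed)
  moreover have "upper ?D" "?D $ 3 $ 3 = 0"
    using X by (simp_all add: upper_def components)
  ultimately have "?D = 0" by (rule transversal_upper_eq_0[OF A])
  then have "?D $ i $ j = 0" for i j by simp
  from this[of 1 1] this[of 2 3]
  have "X $ 1 $ 2 = X $ 1 $ 1 * X $ 2 $ 2" "X $ 1 $ 3 = X $ 1 $ 1 * X $ 2 $ 3"
    using X by (simp_all add: components algebra_simps)
  then show ?thesis
    using X by (intro that[of X "X $ 1 $ 1" "X $ 2 $ 2" "X $ 2 $ 3"])
      (simp_all add: mat3_eq_iff forall_3 components)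
qed

text \<open>
  The conjugation sends the column \<open>(\<alpha>, 1, 0)\<close> to the second basis vector and clears the last entry
  of the row \<open>(1, \<beta>, \<gamma>)\<close>. The trace \<open>\<alpha> + \<beta>\<close> is invariant, and if it is not zero it is scaled to one.
\<close>
lemma transversal_conjugate_first_generator:
  assumes A: "transversal A"
  shows "\<exists>f. upper_conjugation_map f \<and> (e 2 1 \<in> f ` A \<or> e 2 1 + e 2 2 \<in> f ` A)"
proof -
  obtain X \<alpha> \<beta> \<gamma> where XA: "X \<in> A"
    and X: "X = \<alpha> *\<^sub>C e 1 1 + (\<alpha> * \<beta>) *\<^sub>C e 1 2 + (\<alpha> * \<gamma>) *\<^sub>C e 1 3 + e 2 1 + \<beta> *\<^sub>C e 2 2 + \<gamma> *\<^sub>C e 2 3"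
    using transversal_rank_one[OF A] by blast
  define \<kappa> where "\<kappa> = \<alpha> + \<beta>"
  \<comment> \<open>The scaling factor has to stay invertible when the trace is zero.\<close>
  define \<mu> where "\<mu> = (if \<kappa> = 0 then 1 else \<kappa>)"
  have \<mu>: "\<mu> \<noteq> 0" "\<kappa> = 0 \<or> \<mu> = \<kappa>" by (auto simp: \<mu>_def)
  let ?P = "(1 / \<mu>) *\<^sub>C (e 1 1 - \<alpha> *\<^sub>C e 1 2 + \<gamma> *\<^sub>C e 1 3) + e 2 2 + e 3 3"
  let ?Q = "\<mu> *\<^sub>C e 1 1 + \<alpha> *\<^sub>C e 1 2 - \<gamma> *\<^sub>C e 1 3 + e 2 2 + e 3 3"
  let ?f = "conjugation ?P ?Q"
  have "?P ** ?Q = mat 1"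
    using \<mu> by (simp add: mat3_eq_iff forall_3 components mat_def)
  moreover have "upper ?P" "upper ?Q" by (simp_all add: upper_def components)
  ultimately have f: "upper_conjugation_map ?f"
    unfolding upper_conjugation_map_def by blast
  have fX: "?f X = \<mu> *\<^sub>C e 2 1 + \<kappa> *\<^sub>C e 2 2"
    unfolding X conjugation_def using \<mu>
    by (simp add: mat3_eq_iff forall_3 components \<kappa>_def algebra_simps)
  have "(1 / \<mu>) *\<^sub>C ?f X \<in> ?f ` A"
    using transversal_conjugation[OF A f] XA by (simp add: transversal_def subalgebra_scale)
  moreover have "(1 / \<mu>) *\<^sub>C ?f X = e 2 1 \<or> (1 / \<mu>) *\<^sub>C ?f X = e 2 1 + e 2 2"
    using \<mu> unfolding fX by (auto simp: mat3_eq_iff forall_3 components)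
  ultimately have "e 2 1 \<in> ?f ` A \<or> e 2 1 + e 2 2 \<in> ?f ` A"
    by (auto simp only:)
  with f show ?thesis by (intro exI conjI)
qed

text \<open>
  Let \<open>a\<close> be the given element, and \<open>b\<close>, \<open>c\<close> those with entries \<open>(0, 1, 0)\<close> and \<open>(0, 0, 1)\<close> at the positions
  \<open>(2, 1)\<close>, \<open>(3, 1)\<close>, \<open>(3, 2)\<close> and vanishing \<open>(2, 2)\<close> entry. The rows two and three in the columns one and two
  determine an element of \<open>A\<close>, and those of a product are known once the factors are; comparing
  the other entries of \<open>a b\<close>, \<open>a c\<close>, \<open>c a\<close> and \<open>c\<^sup>2\<close> leaves only \<open>r = c $ 1 $ 1\<close> and \<open>s = c $ 3 $ 3\<close> free.
\<close>
lemma transversal_normal_form: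
  assumes A: "transversal A" and a: "e 2 1 + \<kappa> *\<^sub>C e 2 2 \<in> A"
  obtains r s where
    "e 3 1 + (\<kappa> * r * (r - s)) *\<^sub>C (\<kappa> *\<^sub>C e 1 3 - e 2 3) - (\<kappa> * s) *\<^sub>C e 3 3 \<in> A"
    "r *\<^sub>C (e 1 1 + \<kappa> *\<^sub>C e 1 2) - (r * (r - s)) *\<^sub>C (\<kappa> *\<^sub>C e 1 3 - e 2 3) + e 3 2 + s *\<^sub>C e 3 3 \<in> A"
proof -
  define a where "a = e 2 1 + \<kappa> *\<^sub>C e 2 2"
  have aA: "a \<in> A" using a by (simp add: a_def)
  obtain b where b: "b \<in> A" "b $ 2 $ 1 = 0" "b $ 3 $ 1 = 1" "b $ 3 $ 2 = 0" "b $ 2 $ 2 = 0"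
    using transversal_obtains_lower[OF A] by blast
  obtain c where c: "c \<in> A" "c $ 2 $ 1 = 0" "c $ 3 $ 1 = 0" "c $ 3 $ 2 = 1" "c $ 2 $ 2 = 0"
    using transversal_obtains_lower[OF A] by blast
  \<comment> \<open>The coefficient of \<open>E\<close> corrects for the \<open>(2, 2)\<close> entry \<open>\<kappa>\<close> of \<open>a\<close>.\<close>
  have expand: "X = (X $ 2 $ 1) *\<^sub>C a + (X $ 3 $ 1) *\<^sub>C b + (X $ 3 $ 2) *\<^sub>C c
      + (X $ 2 $ 2 - \<kappa> * X $ 2 $ 1) *\<^sub>C E" if X: "X \<in> A" for X
  proof -
    let ?D = "X - (X $ 2 $ 1) *\<^sub>C a - (X $ 3 $ 1) *\<^sub>C b - (X $ 3 $ 2) *\<^sub>C c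
      - (X $ 2 $ 2 - \<kappa> * X $ 2 $ 1) *\<^sub>C E"
    have "?D \<in> A" using X aA b c A by (simp add: transversal_def subalgebra_closed)
    moreover have "upper ?D" "?D $ 2 $ 2 = 0"
      using b c by (simp_all add: upper_def components a_def)
    ultimately have "?D = 0" by (rule transversal_upper_eq_0[OF A])
    then show ?thesis by (simp add: algebra_simps)
  qed
  have prod: "(X ** Y) $ i $ j = ((X ** Y) $ 2 $ 1) * a $ i $ j + ((X ** Y) $ 3 $ 1) * b $ i $ j
      + ((X ** Y) $ 3 $ 2) * c $ i $ j + ((X ** Y) $ 2 $ 2 - \<kappa> * (X ** Y) $ 2 $ 1) * E $ i $ j"
    if "X \<in> A" "Y \<in> A" for X Y i j
  proof -
    have "X ** Y \<in> A" using that A by (simp add: transversal_def subalgebra_mult)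
    from arg_cong[OF expand[OF this], of "\<lambda>Z. Z $ i $ j"] show ?thesis
      by (simp only: vector_add_component mscale_component)
  qed
  have a_comp: "a $ i $ j = (if i = 2 \<and> j = 1 then 1 else if i = 2 \<and> j = 2 then \<kappa> else 0)" for i j
    by (simp add: a_def components)
  note simps = mult_component a_comp E_component b c
  have b12: "b $ 1 $ 2 = \<kappa> * b $ 1 $ 1"
    using prod[OF aA b(1), of 1 1] by (simp add: simps)
  have b13: "b $ 1 $ 3 = - \<kappa> * b $ 2 $ 3"
    using prod[OF aA b(1), of 2 3] by (simp add: simps eq_neg_iff_add_eq_0)
  have c12: "c $ 1 $ 2 = \<kappa> * c $ 1 $ 1"
    using prod[OF aA c(1), of 1 1] by (simp add: simps)
  have c13: "c $ 1 $ 3 = - \<kappa> * c $ 2 $ 3"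
    using prod[OF aA c(1), of 2 3] by (simp add: simps eq_neg_iff_add_eq_0)
  have b11: "b $ 1 $ 1 = 0"
    using prod[OF c(1) aA, of 1 1] by (simp add: simps c12)
  have b23: "b $ 2 $ 3 = - \<kappa> * c $ 2 $ 3"
    using prod[OF c(1) aA, of 2 3] by (simp add: simps eq_neg_iff_add_eq_0)
  have b33: "b $ 3 $ 3 = - \<kappa> * c $ 3 $ 3"
    using prod[OF c(1) aA, of 3 3] by (simp add: simps eq_neg_iff_add_eq_0)
  have c23: "c $ 2 $ 3 = c $ 1 $ 1 * (c $ 1 $ 1 - c $ 3 $ 3)"
    using prod[OF c(1) c(1), of 1 1] by (simp add: simps algebra_simps)
  let ?r = "c $ 1 $ 1" and ?s = "c $ 3 $ 3"
  have "b = e 3 1 + (\<kappa> * ?r * (?r - ?s)) *\<^sub>C (\<kappa> *\<^sub>C e 1 3 - e 2 3) - (\<kappa> * ?s) *\<^sub>C e 3 3"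
    by (simp add: mat3_eq_iff forall_3 components b b11 b12 b13 b23 b33 c23)
  moreover have "c = ?r *\<^sub>C (e 1 1 + \<kappa> *\<^sub>C e 1 2)
      - (?r * (?r - ?s)) *\<^sub>C (\<kappa> *\<^sub>C e 1 3 - e 2 3) + e 3 2 + ?s *\<^sub>C e 3 3"
    by (simp add: mat3_eq_iff forall_3 components c c12 c13 c23)
  ultimately show ?thesis using that[of ?r ?s] b(1) c(1) by simp
qed

section \<open>Scaling the parameters away\<close>

definition diag3 :: "complex \<Rightarrow> mat3 \<Rightarrow> mat3"
  where "diag3 d = conjugation (e 1 1 + e 2 2 + d *\<^sub>C e 3 3) (e 1 1 + e 2 2 + (1 / d) *\<^sub>C e 3 3)"

lemma diag3_component:
  "diag3 d X $ i $ j = (if i = 3 then d else 1) * (if j = 3 then 1 / d else 1) * X $ i $ j"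
  using exhaust_3[of i] exhaust_3[of j]
  by (auto simp: diag3_def conjugation_def components)

lemma upper_conjugation_map_diag3: "d \<noteq> 0 \<Longrightarrow> upper_conjugation_map (diag3 d)"
  unfolding upper_conjugation_map_def diag3_def
  by (intro exI conjI, rule_tac[4] refl)
    (simp_all add: upper_def mat3_eq_iff forall_3 components mat_def)

text \<open>
  With \<open>\<kappa> = 0\<close> in the normal form, \<open>b\<close> is \<open>e 3 1\<close>, and \<open>c\<close> has the eigenvalues \<open>r\<close>, \<open>r\<close> and \<open>s - r\<close>
  up to order. Apart from the choice of scale only two questions matter:
  whether \<open>r - s\<close>, and then \<open>r\<close>, is zero.
\<close>
lemma transversal_classification_nilpotent:
  assumes A: "transversal A" and a: "e 2 1 \<in> A"
  shows "\<exists>f. upper_conjugation_map f \<and>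
    (f ` A = mat3.span {E, e 2 1, e 3 1, e 3 2} \<or>
     f ` A = mat3.span {E, e 2 1, e 3 1, e 3 2 + e 2 2} \<or>
     (\<exists>p. f ` A = mat3.span {E, e 2 1, e 3 1, e 1 1 + p *\<^sub>C e 2 2 + (1 - p) *\<^sub>C e 2 3 + e 3 2}))"
proof -
  have "e 2 1 + 0 *\<^sub>C e 2 2 \<in> A" using a by simp
  from transversal_normal_form[OF A this] obtain r s where b: "e 3 1 \<in> A"
    and c: "r *\<^sub>C e 1 1 + (r * (r - s)) *\<^sub>C e 2 3 + e 3 2 + s *\<^sub>C e 3 3 \<in> A"
    by auto
  define c where "c = r *\<^sub>C e 1 1 + (r * (r - s)) *\<^sub>C e 2 3 + e 3 2 + s *\<^sub>C e 3 3"
  have cA: "c \<in> A" using c by (simp add: c_def)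
  define d where "d = (if r \<noteq> s then r - s else if r \<noteq> 0 then - r else 1)"
  have d: "d \<noteq> 0" by (auto simp: d_def)
  let ?f = "diag3 d"
  have f: "upper_conjugation_map ?f" using d by (rule upper_conjugation_map_diag3)
  have fA: "transversal (?f ` A)" using A f by (rule transversal_conjugation)
  then have sub: "subalgebra (?f ` A)" "E \<in> ?f ` A" by (simp_all add: transversal_def)
  have "?f (e 2 1) = e 2 1"
    by (auto simp: mat3_eq_iff diag3_component components)
  then have a': "e 2 1 \<in> ?f ` A" using a by (metis imageI)
  have "(1 / d) *\<^sub>C ?f (e 3 1) = e 3 1"
    using d by (auto simp: mat3_eq_iff diag3_component components)
  then have b': "e 3 1 \<in> ?f ` A" using b sub by (metis imageI subalgebra_scale)
  have c': "(1 / d) *\<^sub>C ?f c + k *\<^sub>C E \<in> ?f ` A" for k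
    using cA sub by (simp add: subalgebra_closed)
  note span = transversal_eq_span[OF fA a' b']
  show ?thesis
  proof (cases "r = s")
    case False
    have r: "r = d + s" using False by (simp add: d_def)
    \<comment> \<open>The scalar \<open>p\<close> is the one that cancels the \<open>(3, 3)\<close> entry after rescaling.\<close>
    define p where "p = 1 - r / d"
    have "(1 / d) *\<^sub>C ?f c + p *\<^sub>C E = e 1 1 + p *\<^sub>C e 2 2 + (1 - p) *\<^sub>C e 2 3 + e 3 2"
      using d by (simp add: mat3_eq_iff forall_3 diag3_component components c_def p_def r field_simps)
    then have "e 1 1 + p *\<^sub>C e 2 2 + (1 - p) *\<^sub>C e 2 3 + e 3 2 \<in> ?f ` A" using c' by metis
    from span[OF this]
    have "?f ` A = mat3.span {E, e 2 1, e 3 1, e 1 1 + p *\<^sub>C e 2 2 + (1 - p) *\<^sub>C e 2 3 + e 3 2}"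
      by (simp add: components)
    then show ?thesis using f by (intro exI[of _ ?f]) blast
  next
    case True
    show ?thesis
    proof (cases "r = 0")
      case r: True
      have "(1 / d) *\<^sub>C ?f c + 0 *\<^sub>C E = e 3 2"
        using True r by (simp add: mat3_eq_iff forall_3 diag3_component components c_def d_def)
      then have "e 3 2 \<in> ?f ` A" using c' by metis
      from span[OF this] have "?f ` A = mat3.span {E, e 2 1, e 3 1, e 3 2}"
        by (simp add: components)
      then show ?thesis using f by (intro exI[of _ ?f]) blast
    next
      case r: False
      have "(1 / d) *\<^sub>C ?f c + 1 *\<^sub>C E = e 3 2 + e 2 2"
        using True r by (simp add: mat3_eq_iff forall_3 diag3_component components c_def d_def)
      then have "e 3 2 + e 2 2 \<in> ?f ` A" using c' by metis
      from span[OF this] have "?f ` A = mat3.span {E, e 2 1, e 3 1, e 3 2 + e 2 2}"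
        by (simp add: components)
      then show ?thesis using f by (intro exI[of _ ?f]) blast
    qed
  qed
qed

text \<open>
  With \<open>\<kappa> = 1\<close> in the normal form, the sum of \<open>b\<close> and \<open>c\<close> is simpler than \<open>c\<close>: the terms with \<open>e 1 3\<close>, \<open>e 2 3\<close>
  and \<open>e 3 3\<close> cancel. The scale is used to make \<open>s\<close>, or else \<open>r\<close>, equal to one.
\<close>
lemma transversal_classification_idempotent:
  assumes A: "transversal A" and a: "e 2 1 + e 2 2 \<in> A"
  shows "\<exists>f. upper_conjugation_map f \<and>
    (f ` A = mat3.span {E, e 2 1 + e 2 2, e 3 1, e 3 2} \<or>
     f ` A = mat3.span {E, e 2 1 + e 2 2, e 3 1 + e 1 3 - e 2 3, e 1 1 + e 1 2 + e 3 1 + e 3 2} \<or>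
     (\<exists>m. f ` A = mat3.span
       {E, e 2 1 + e 2 2, e 3 1 + (m * (m + 1)) *\<^sub>C (e 1 3 - e 2 3) - e 3 3,
        e 3 1 + e 3 2 + (m + 1) *\<^sub>C (e 1 1 + e 1 2)}))"
proof -
  have "e 2 1 + 1 *\<^sub>C e 2 2 \<in> A" using a by simp
  from transversal_normal_form[OF A this] obtain r s where
      b: "e 3 1 + (r * (r - s)) *\<^sub>C (e 1 3 - e 2 3) - s *\<^sub>C e 3 3 \<in> A"
    and c: "r *\<^sub>C (e 1 1 + e 1 2) - (r * (r - s)) *\<^sub>C (e 1 3 - e 2 3) + e 3 2 + s *\<^sub>C e 3 3 \<in> A"
    by auto
  define b where "b = e 3 1 + (r * (r - s)) *\<^sub>C (e 1 3 - e 2 3) - s *\<^sub>C e 3 3"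
  define c where
    "c = r *\<^sub>C (e 1 1 + e 1 2) - (r * (r - s)) *\<^sub>C (e 1 3 - e 2 3) + e 3 2 + s *\<^sub>C e 3 3"
  have bc: "b \<in> A" "c \<in> A" using b c by (simp_all add: b_def c_def)
  define d where "d = (if s \<noteq> 0 then s else if r \<noteq> 0 then r else 1)"
  have d: "d \<noteq> 0" by (auto simp: d_def)
  let ?f = "diag3 d"
  have f: "upper_conjugation_map ?f" using d by (rule upper_conjugation_map_diag3)
  have fA: "transversal (?f ` A)" using A f by (rule transversal_conjugation)
  then have sub: "subalgebra (?f ` A)" "E \<in> ?f ` A" by (simp_all add: transversal_def)
  have "?f (e 2 1 + e 2 2) = e 2 1 + e 2 2"
    by (auto simp: mat3_eq_iff diag3_component components)
  then have a': "e 2 1 + e 2 2 \<in> ?f ` A" using a by (metis imageI)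
  have b': "(1 / d) *\<^sub>C ?f b \<in> ?f ` A" using bc sub by (simp add: subalgebra_closed)
  have c': "(1 / d) *\<^sub>C ?f c \<in> ?f ` A" using bc sub by (simp add: subalgebra_closed)
  have bc': "(1 / d) *\<^sub>C ?f b + (1 / d) *\<^sub>C ?f c \<in> ?f ` A"
    using b' c' sub by (simp add: subalgebra_closed)
  note span = transversal_eq_span[OF fA a']
  show ?thesis
  proof (cases "s = 0")
    case False
    define m where "m = r / s - 1"
    have "(1 / d) *\<^sub>C ?f b = e 3 1 + (m * (m + 1)) *\<^sub>C (e 1 3 - e 2 3) - e 3 3"
      using False by (simp add: mat3_eq_iff forall_3 diag3_component components b_def m_def d_def field_simps)
    note B = b'[unfolded this]
    have "(1 / d) *\<^sub>C ?f b + (1 / d) *\<^sub>C ?f c = e 3 1 + e 3 2 + (m + 1) *\<^sub>C (e 1 1 + e 1 2)"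
      using False by (simp add: mat3_eq_iff forall_3 diag3_component components b_def c_def m_def d_def field_simps)
    note C = bc'[unfolded this]
    have "?f ` A = mat3.span
       {E, e 2 1 + e 2 2, e 3 1 + (m * (m + 1)) *\<^sub>C (e 1 3 - e 2 3) - e 3 3,
        e 3 1 + e 3 2 + (m + 1) *\<^sub>C (e 1 1 + e 1 2)}"
      by (rule span[OF B C]) (simp_all add: components)
    then show ?thesis using f by (intro exI[of _ ?f]) blast
  next
    case s: True
    show ?thesis
    proof (cases "r = 0")
      case True
      have "(1 / d) *\<^sub>C ?f b = e 3 1"
        using s True by (simp add: mat3_eq_iff forall_3 diag3_component components b_def d_def)
      note B = b'[unfolded this]
      have "(1 / d) *\<^sub>C ?f c = e 3 2"
        using s True by (simp add: mat3_eq_iff forall_3 diag3_component components c_def d_def)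
      note C = c'[unfolded this]
      have "?f ` A = mat3.span {E, e 2 1 + e 2 2, e 3 1, e 3 2}"
        by (rule span[OF B C]) (simp_all add: components)
      then show ?thesis using f by (intro exI[of _ ?f]) blast
    next
      case False
      have "(1 / d) *\<^sub>C ?f b = e 3 1 + e 1 3 - e 2 3"
        using s False by (simp add: mat3_eq_iff forall_3 diag3_component components b_def d_def)
      note B = b'[unfolded this]
      have "(1 / d) *\<^sub>C ?f b + (1 / d) *\<^sub>C ?f c = e 1 1 + e 1 2 + e 3 1 + e 3 2"
        using s False by (simp add: mat3_eq_iff forall_3 diag3_component components b_def c_def d_def)
      note C = bc'[unfolded this]
      have "?f ` A = mat3.span
          {E, e 2 1 + e 2 2, e 3 1 + e 1 3 - e 2 3, e 1 1 + e 1 2 + e 3 1 + e 3 2}"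
        by (rule span[OF B C]) (simp_all add: components)
      then show ?thesis using f by (intro exI[of _ ?f]) blast
    qed
  qed
qed

section \<open>The decomposition theorem\<close>

theorem theorem4:
  fixes A B :: "mat3 set"
  assumes "subalgebra A" and "subalgebra B"
    and "direct_decomposition A B"
    and "mat3.dim A = 4" and "mat3.dim B = 5"
    and "unital A"
  shows "\<exists>\<phi> M S. (automorphism \<phi> \<or> antiautomorphism \<phi>) \<and> \<phi> ` B = M \<and> \<phi> ` A = S \<and>
    (M = mat3.span {e 1 1, e 1 2, e 1 3, e 2 2, e 2 3} \<or>
     M = mat3.span {e 1 1, e 1 2, e 1 3, e 2 3, e 3 3}) \<and>
    (S = mat3.span {E, e 2 1, e 3 1, e 3 2} \<or>
     S = mat3.span {E, e 2 1 + e 2 2, e 3 1, e 3 2} \<or>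
     S = mat3.span {E, e 2 1, e 3 1, e 3 2 + e 2 2} \<or>
     S = mat3.span {E, e 2 1 + e 2 2, e 3 1 + e 1 3 - e 2 3, e 1 1 + e 1 2 + e 3 1 + e 3 2} \<or>
     (\<exists>p. S = mat3.span
       {E, e 2 1, e 3 1, e 1 1 + p *\<^sub>C e 2 2 + (1 - p) *\<^sub>C e 2 3 + e 3 2}) \<or>
     (\<exists>p. S = mat3.span
       {E, e 2 1 - e 2 3, e 3 1 + e 1 1 - e 1 3 - e 3 3,
        e 1 1 + e 1 2 - e 1 3 + p *\<^sub>C e 2 2 + (1 - p) *\<^sub>C e 2 3 + e 3 2}) \<or>
     (\<exists>m. S = mat3.span
       {E, e 2 1 + e 2 2, e 3 1 + (m * (m + 1)) *\<^sub>C (e 1 3 - e 2 3) - e 3 3,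
        e 3 1 + e 3 2 + (m + 1) *\<^sub>C (e 1 1 + e 1 2)}) \<or>
     (\<exists>m p. S = mat3.span
       {E, e 2 1 + e 2 2 - e 2 3,
        (m - p + 1) *\<^sub>C (e 1 1 + e 1 2 - e 1 3) + e 3 1 + e 3 2 - e 3 3,
        e 1 1 + e 3 1 + ((m - 1) * (m - p + 1)) *\<^sub>C e 1 3
          - (m * (m - p)) *\<^sub>C e 2 3 + (p - 1) *\<^sub>C e 3 3}))"
    (is "\<exists>\<phi> M S. _ \<and> _ \<and> _ \<and> _ \<and> ?listed S")
proof -
  have EA: "E \<in> A" using assms by (simp add: unital_def)
  have "E $ 1 $ 1 \<noteq> 0" by (simp add: components)
  then have "E \<noteq> 0" by auto
  then have "E \<notin> B" using EA assms by (auto simp: direct_decomposition_def)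
  then have "standardisable B"
    using assms by (intro nonunital5_standardisable) (simp add: nonunital5_def)
  then obtain f k where f: "symmetry f" and k: "k = 2 \<or> k = 3" and fB: "f ` B = upper_vanishing k"
    unfolding standardisable_def by blast
  have "direct_decomposition (f ` A) (upper_vanishing k)"
    using direct_decomposition_symmetry_image[OF f] assms fB by metis
  moreover have "E \<in> f ` A" using EA symmetry_E[OF f] by (metis imageI)
  ultimately have T: "transversal (f ` A)"
    using subalgebra_symmetry_image[OF f] assms by (intro transversal_if_complement)
  obtain g where g: "upper_conjugation_map g"
    and first: "e 2 1 \<in> g ` f ` A \<or> e 2 1 + e 2 2 \<in> g ` f ` A"
    using transversal_conjugate_first_generator[OF T] by blast
  have "transversal (g ` f ` A)" using T g by (rule transversal_conjugation)
  then have "\<exists>h. upper_conjugation_map h \<and> ?listed (h ` g ` f ` A)"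
    using first transversal_classification_nilpotent transversal_classification_idempotent by metis
  then obtain h where "upper_conjugation_map h \<and> ?listed (h ` g ` f ` A)" by (rule exE)
  then have h: "upper_conjugation_map h" and S: "?listed (h ` g ` f ` A)"
    by (rule conjunct1, rule conjunct2)
  define \<phi> where "\<phi> = h \<circ> (g \<circ> f)"
  have "symmetry \<phi>"
    unfolding \<phi>_def
    by (intro symmetry_comp f upper_conjugation_map_symmetry[OF g] upper_conjugation_map_symmetry[OF h])
  moreover have "\<phi> ` B = upper_vanishing k"
    using upper_conjugation_map_upper_vanishing[OF g] upper_conjugation_map_upper_vanishing[OF h] fB
    by (simp only: \<phi>_def image_comp[symmetric])
  then have "\<phi> ` B = mat3.span {e 1 1, e 1 2, e 1 3, e 2 2, e 2 3} \<or>
      \<phi> ` B = mat3.span {e 1 1, e 1 2, e 1 3, e 2 3, e 3 3}"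
    using k upper_vanishing_2_eq_span upper_vanishing_3_eq_span by auto
  moreover have "?listed (\<phi> ` A)"
    using S by (simp only: \<phi>_def image_comp[symmetric])
  ultimately show ?thesis
    unfolding symmetry_def by (intro exI[of _ \<phi>] exI[of _ "\<phi> ` B"] exI[of _ "\<phi> ` A"] conjI refl)
qed

end
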